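(* In each of the two cases (shuffle case, attached to a formal vector field; quasishuffle case, attached to a formal tangent-to-identity diffeomorphism) described in the context, with $\rho$, $\rho^<$ and the graded dual $\alpha^\circ$ of the arborification morphism $\alpha$ defined there, $$\rho^<\circ\alpha^{\circ}=\rho .$$
   Context: Fix $\nu\ge1$, $x=(x_1,\dots,x_\nu)$, and let $e_i$ be the $i$-th canonical basis vector of $\mathbb{Z}^\nu$. For $1\le i\le\nu$ let $H_i=\{n-e_i:\ n\in\mathbb{N}^\nu,\ |n|\ge 2\}$ ($\mathbb N\ni0$, $|n|=n_1+\dots+n_\nu$), $H=H_1\cup\dots\cup H_\nu$, and let $\bar H$ be the additive semigroup generated by $H$. Put $x^\eta=x_1^{\eta_1}\cdots x_\nu^{\eta_\nu}$ and $\mathrm{gr}(\eta)=|\eta|$. $\mathbb{C}[x,\partial_x]$ is the algebra of differential operators with polynomial coefficients. Words. For an alphabet $A$ ($A=H$ or $\bar H$), $\mathrm{Conc}_A$ is the linear span of the words in $A$ (empty word $\emptyset$), with concatenation product, graded by $\mathrm{gr}(\eta_1,\dots,\eta_s)=\sum|\eta_k|$. $\mathrm{Sh}_H$ is the Hopf algebra on the span of words in $H$ with shuffle product and deconcatenation coproduct $\Delta(w)=\sum_{w^1w^2=w}w^1\otimes w^2$. $\mathrm{QSh}_{\bar H}$ is the Hopf algebra on the span of words in $\bar H$ with deconcatenation coproduct and quasishuffle product $\ast$: $\emptyset\ast w=w\ast\emptyset=w$, $(aw)\ast(bw')=a(w\ast bw')+b(aw\ast w')+(a+b)(w\ast w')$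 for letters $a,b$. As graded vector spaces, the graded duals of $\mathrm{Sh}_H$ and $\mathrm{QSh}_{\bar H}$ are identified with $\mathrm{Conc}_H$ and $\mathrm{Conc}_{\bar H}$ through the dual bases of words. For $\eta\in H$, $L^\eta_+(\eta_1,\dots,\eta_s)=(\eta,\eta_1,\dots,\eta_s)$. Trees. $\mathcal F_H$ is the set of forests of non-planar rooted trees with vertices decorated by $H$, including the empty forest $\emptyset$. $B^+_\eta(F)$ is the tree obtained by joining the roots of $F$ to a new root decorated by $\eta$. The Connes–Kreimer Hopf algebra $\mathrm{CK}_H$ is the span of $\mathcal F_H$ with product the disjoint union of forests, unit $\emptyset$, and coproduct the algebra morphism with $\Delta(B^+_\eta(F))=B^+_\eta(F)\otimes\emptyset+(\mathrm{Id}\otimes B^+_\eta)\circ\Delta(F)$. $\mathrm{CK}_H^\circ$ is its graded dual (grading: sum of the $|\eta|$ over decorations), with the dual basis identified with $\mathcal F_H$. Arborification. $\alpha:\mathrm{CK}_H\to\mathrm{Sh}_H$ (shuffle case) or $\alpha:\mathrm{CK}_H\to\mathrm{QSh}_{\bar H}$ (quasishuffle case) is the unique morphism of unital algebras with $\alpha\circ B^+_\eta=L^\eta_+\circ\alpha$ for all $\eta\in H$. $\alpha^\circ$ is the graded dual map from $\mathrm{Conc}_H$ (resp. $\mathrm{Conc}_{\bar H}$) to $\mathrm{CK}_H^\circ$: $\langle\alpha^\circ(w),F\rangle=\langle w,\alpha(F)\rangle$ for words $w$ and forests $F$. The map $\rho$. Let $a^i_\eta\in\mathbb C$ ($1\le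 i\le\nu$, $\eta\in H$), with $a^i_\eta=0$ if $\eta\notin H_i$. - Shuffle case: $P=\sum_{\eta\in H}\mathbb B_\eta$ with $\mathbb B_\eta=\sum_ia^i_\eta x^\eta x_i\partial_{x_i}$; $\rho:\mathrm{Conc}_H\to\mathbb{C}[x,\partial_x]$ is linear with $\rho(\emptyset)=\mathrm{Id}$, $\rho(\eta_1,\dots,\eta_s)=\mathbb B_{\eta_s}\cdots\mathbb B_{\eta_1}$. - Quasishuffle case: $f_i(x)=x_i(1+\sum_{\eta\in H_i}a^i_\eta x^\eta)$ and the substitution operator $u\mapsto u\circ f$ decomposes as $\mathrm{Id}+\sum_{\eta\in\bar H}\mathbb D_\eta$ with $$\mathbb D_\eta=\sum_{s\ge1}\ \sum_{\eta_1+\dots+\eta_s=\eta,\ \eta_k\in H}\ \sum_{1\le i_1,\dots,i_s\le\nu}\frac1{s!}a^{i_1}_{\eta_1}\cdots a^{i_s}_{\eta_s}x^{\eta}x_{i_1}\cdots x_{i_s}\partial_{x_{i_1}}\cdots\partial_{x_{i_s}};$$ $\rho:\mathrm{Conc}_{\bar H}\to\mathbb{C}[x,\partial_x]$ is linear with $\rho(\emptyset)=\mathrm{Id}$, $\rho(\eta_1,\dots,\eta_s)=\mathbb D_{\eta_s}\cdots\mathbb D_{\eta_1}$. The map $\rho^<:\mathrm{CK}_H^\circ\to\mathbb{C}[x,\partial_x]$ (homogeneous coarborification) is linear and defined on $\mathcal F_H$ recursively by: $\rho^<(\emptyset)=\mathrm{Id}$; for a tree $T=B^+_\eta(F)$,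 $\rho^<(T)=\sum_{i=1}^\nu(\rho^<(F).(\rho((\eta)).x_i))\partial_{x_i}$; for $F=T_1\cdots T_s$ with $s\ge2$ trees, consisting of $k$ distinct decorated trees with multiplicities $d_1,\dots,d_k$, $\rho^<(F)=\frac{1}{d_1!\cdots d_k!}\sum_{1\le i_1,\dots,i_s\le\nu}(\rho^<(T_1).x_{i_1})\cdots(\rho^<(T_s).x_{i_s})\partial_{x_{i_1}}\cdots\partial_{x_{i_s}}$. *)

theory Defs
  imports
    "HOL-Analysis.Finite_Cartesian_Product"
    "HOL-Library.Poly_Mapping"
    "HOL-Library.Multiset"
    "HOL-Combinatorics.Permutations"
    Complex_Main
begin

section \<open>Free complex vector spaces\<close>

text \<open>The span of a type of basis vectors is the type of finitely supported functions
  \<open>'a \<Rightarrow>\<^sub>0 complex\<close>; the span of a subset of the basis is the corresponding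
  subspace.\<close>

definition basis :: "'a \<Rightarrow> 'a \<Rightarrow>\<^sub>0 complex"
  where "basis k = Poly_Mapping.single k 1"

definition smul :: "complex \<Rightarrow> ('a \<Rightarrow>\<^sub>0 complex) \<Rightarrow> ('a \<Rightarrow>\<^sub>0 complex)"
  where "smul c u = Poly_Mapping.map ((*) c) u"

definition lin_ext :: "('a \<Rightarrow> 'b \<Rightarrow>\<^sub>0 complex) \<Rightarrow> ('a \<Rightarrow>\<^sub>0 complex) \<Rightarrow> ('b \<Rightarrow>\<^sub>0 complex)"
  where "lin_ext f u = (\<Sum>k\<in>Poly_Mapping.keys u. smul (Poly_Mapping.lookup u k) (f k))"

definition bilin_ext ::
  "('a \<Rightarrow> 'a \<Rightarrow> 'b \<Rightarrow>\<^sub>0 complex) \<Rightarrow> ('a \<Rightarrow>\<^sub>0 complex) \<Rightarrow> ('a \<Rightarrow>\<^sub>0 complex) \<Rightarrow> ('b \<Rightarrow>\<^sub>0 complex)"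
  where "bilin_ext f u v = lin_ext (\<lambda>k. lin_ext (f k) v) u"

definition pairing :: "('a \<Rightarrow>\<^sub>0 complex) \<Rightarrow> ('a \<Rightarrow>\<^sub>0 complex) \<Rightarrow> complex"
  where "pairing u v =
    (\<Sum>k\<in>Poly_Mapping.keys u. Poly_Mapping.lookup u k * Poly_Mapping.lookup v k)"

definition linear_span :: "'a set \<Rightarrow> ('a \<Rightarrow>\<^sub>0 complex) set"
  where "linear_span S = {u. Poly_Mapping.keys u \<subseteq> S}"

section \<open>Multi-indices\<close>

definition gr :: "int ^ 'n::finite \<Rightarrow> int"
  where "gr \<eta> = (\<Sum>j\<in>UNIV. \<eta> $ j)"

definition Hi :: "'n::finite \<Rightarrow> (int ^ 'n) set"
  where "Hi i = {n - axis i 1 | n. (\<forall>j. 0 \<le> n $ j) \<and> 2 \<le> gr n}"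

definition H :: "(int ^ 'n::finite) set"
  where "H = (\<Union>i. Hi i)"

inductive_set Hbar :: "(int ^ 'n::finite) set"
  where
    "\<eta> \<in> H \<Longrightarrow> \<eta> \<in> Hbar"
  | "\<eta> \<in> Hbar \<Longrightarrow> \<theta> \<in> Hbar \<Longrightarrow> \<eta> + \<theta> \<in> Hbar"

section \<open>Polynomials and differential operators\<close>

text \<open>Polynomials in the variables \<open>x\<^sub>i\<close> (\<open>i\<close> ranging over the index type) are finitely
  supported functions on exponent vectors, with the convolution product of the library.
  Differential operators are represented by their (faithful) action on polynomials.\<close>

type_synonym 'n cpoly = "(nat ^ 'n) \<Rightarrow>\<^sub>0 complex"
type_synonym 'n oper = "'n cpoly \<Rightarrow> 'n cpoly"

definition X :: "'n::finite \<Rightarrow> 'n cpoly"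
  where "X i = basis (axis i 1)"

definition pd :: "'n::finite \<Rightarrow> 'n oper"
  where "pd i = lin_ext (\<lambda>m. smul (of_nat (m $ i)) (basis (m - axis i 1)))"

definition pds :: "'n::finite list \<Rightarrow> 'n oper"
  where "pds is = foldr pd is"

text \<open>Monomial with integer exponents; it is only used with a nonzero coefficient when all
  exponents are nonnegative.\<close>

definition xpow :: "int ^ 'n::finite \<Rightarrow> 'n cpoly"
  where "xpow m = basis (\<chi> j. nat (m $ j))"

inductive_set diff_ops :: "('n::finite oper) set"
  where
    mult_op: "(\<lambda>u. p * u) \<in> diff_ops"
  | pd_op: "pd i \<in> diff_ops"
  | add_op: "P \<in> diff_ops \<Longrightarrow> Q \<in> diff_ops \<Longrightarrow> (\<lambda>u. P u + Q u) \<in> diff_ops"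
  | comp_op: "P \<in> diff_ops \<Longrightarrow> Q \<in> diff_ops \<Longrightarrow> P \<circ> Q \<in> diff_ops"

section \<open>Words\<close>

definition Conc :: "'a set \<Rightarrow> ('a list \<Rightarrow>\<^sub>0 complex) set"
  where "Conc A = linear_span (lists A)"

definition Lplus :: "'a \<Rightarrow> ('a list \<Rightarrow>\<^sub>0 complex) \<Rightarrow> ('a list \<Rightarrow>\<^sub>0 complex)"
  where "Lplus a = lin_ext (\<lambda>w. basis (a # w))"

fun shuffle :: "'a list \<Rightarrow> 'a list \<Rightarrow> ('a list \<Rightarrow>\<^sub>0 complex)"
  where
    "shuffle [] v = basis v"
  | "shuffle w [] = basis w"
  | "shuffle (a # w) (b # v) =
      Lplus a (shuffle w (b # v)) + Lplus b (shuffle (a # w) v)"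

fun quasishuffle :: "'a::ab_semigroup_add list \<Rightarrow> 'a list \<Rightarrow> ('a list \<Rightarrow>\<^sub>0 complex)"
  where
    "quasishuffle [] v = basis v"
  | "quasishuffle w [] = basis w"
  | "quasishuffle (a # w) (b # v) =
      Lplus a (quasishuffle w (b # v)) + Lplus b (quasishuffle (a # w) v)
        + Lplus (a + b) (quasishuffle w v)"

definition sh_mult ::
  "('a list \<Rightarrow>\<^sub>0 complex) \<Rightarrow> ('a list \<Rightarrow>\<^sub>0 complex) \<Rightarrow> ('a list \<Rightarrow>\<^sub>0 complex)"
  where "sh_mult = bilin_ext shuffle"

definition qsh_mult ::
  "('a::ab_semigroup_add list \<Rightarrow>\<^sub>0 complex) \<Rightarrow> ('a list \<Rightarrow>\<^sub>0 complex) \<Rightarrow> ('a list \<Rightarrow>\<^sub>0 complex)"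
  where "qsh_mult = bilin_ext quasishuffle"

section \<open>Forests\<close>

text \<open>A forest is a multiset of trees. The disjoint union of forests is multiset union, so the
  product of the Connes--Kreimer algebra is the convolution product that the library provides
  on \<open>'a forest \<Rightarrow>\<^sub>0 complex\<close>, with unit \<open>basis {#}\<close>.\<close>

datatype 'a tree = Node 'a "'a tree multiset"

type_synonym 'a forest = "'a tree multiset"

definition forests :: "'a set \<Rightarrow> 'a forest set"
  where "forests A = {F. \<forall>T\<in>#F. set_tree T \<subseteq> A}"

definition CK :: "'a set \<Rightarrow> ('a forest \<Rightarrow>\<^sub>0 complex) set"
  where "CK A = linear_span (forests A)"

definition Bplus :: "'a \<Rightarrow> ('a forest \<Rightarrow>\<^sub>0 complex) \<Rightarrow> ('a forest \<Rightarrow>\<^sub>0 complex)"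
  where "Bplus a = lin_ext (\<lambda>F. basis {#Node a F#})"

section \<open>Arborification\<close>

text \<open>The parameter \<open>M\<close> is the product on words, \<open>sh_mult\<close> or \<open>qsh_mult\<close>. The lemmas
  \<open>arbo_sh\<close>, \<open>arbo_qsh\<close> and \<open>arbo_unique\<close> below show that \<open>arbo M\<close> is the unique
  unital algebra morphism intertwining \<open>Bplus\<close> and \<open>Lplus\<close>.\<close>

primrec arbo_tree ::
  "(('a list \<Rightarrow>\<^sub>0 complex) \<Rightarrow> ('a list \<Rightarrow>\<^sub>0 complex) \<Rightarrow> ('a list \<Rightarrow>\<^sub>0 complex)) \<Rightarrow>
    'a tree \<Rightarrow> ('a list \<Rightarrow>\<^sub>0 complex)"
  where "arbo_tree M (Node a F) =
    Lplus a (fold_mset M (basis []) (image_mset (arbo_tree M) F))"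

definition arbo_forest ::
  "(('a list \<Rightarrow>\<^sub>0 complex) \<Rightarrow> ('a list \<Rightarrow>\<^sub>0 complex) \<Rightarrow> ('a list \<Rightarrow>\<^sub>0 complex)) \<Rightarrow>
    'a forest \<Rightarrow> ('a list \<Rightarrow>\<^sub>0 complex)"
  where "arbo_forest M F = fold_mset M (basis []) (image_mset (arbo_tree M) F)"

definition arbo ::
  "(('a list \<Rightarrow>\<^sub>0 complex) \<Rightarrow> ('a list \<Rightarrow>\<^sub>0 complex) \<Rightarrow> ('a list \<Rightarrow>\<^sub>0 complex)) \<Rightarrow>
    ('a forest \<Rightarrow>\<^sub>0 complex) \<Rightarrow> ('a list \<Rightarrow>\<^sub>0 complex)"
  where "arbo M = lin_ext (arbo_forest M)"

text \<open>Graded dual of a linear map on \<open>CK A\<close>: the coefficient of \<open>F\<close> in the image of \<open>u\<close> is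
  \<open>\<langle>u, \<alpha>(F)\<rangle>\<close>. For the arborification maps the function under \<open>Abs_poly_mapping\<close> has finite
  support, see \<open>graded_dual_arbo_sh\<close> and \<open>graded_dual_arbo_qsh\<close>.\<close>

definition graded_dual ::
  "'a set \<Rightarrow> (('a forest \<Rightarrow>\<^sub>0 complex) \<Rightarrow> ('a list \<Rightarrow>\<^sub>0 complex)) \<Rightarrow>
    ('a list \<Rightarrow>\<^sub>0 complex) \<Rightarrow> ('a forest \<Rightarrow>\<^sub>0 complex)"
  where "graded_dual A \<alpha> u =
    Abs_poly_mapping (\<lambda>F. if F \<in> forests A then pairing u (\<alpha> (basis F)) else 0)"

section \<open>The homomorphism on words and the homogeneous coarborification\<close>

definition B_op :: "('n \<Rightarrow> int ^ 'n \<Rightarrow> complex) \<Rightarrow> int ^ 'n \<Rightarrow> 'n::finite oper"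
  where "B_op a \<eta> u = (\<Sum>i\<in>UNIV. smul (a i \<eta>) (xpow (\<eta> + axis i 1) * pd i u))"

definition decomps :: "int ^ 'n::finite \<Rightarrow> (int ^ 'n) list set"
  where "decomps \<eta> = {\<eta>s. \<eta>s \<noteq> [] \<and> set \<eta>s \<subseteq> H \<and> sum_list \<eta>s = \<eta>}"

definition D_op :: "('n \<Rightarrow> int ^ 'n \<Rightarrow> complex) \<Rightarrow> int ^ 'n \<Rightarrow> 'n::finite oper"
  where "D_op a \<eta> u =
    (\<Sum>\<eta>s\<in>decomps \<eta>. \<Sum>is | length is = length \<eta>s.
      smul (1 / fact (length \<eta>s) * (\<Prod>k<length \<eta>s. a (is ! k) (\<eta>s ! k)))
        (xpow (\<eta> + (\<Sum>i\<leftarrow>is. axis i 1)) * pds is u))"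

text \<open>The parameter \<open>E\<close> is the family of operators attached to the letters, \<open>B_op a\<close> or
  \<open>D_op a\<close>. Note that \<open>fold E [\<eta>\<^sub>1, \<dots>, \<eta>\<^sub>s] = E \<eta>\<^sub>s \<circ> \<dots> \<circ> E \<eta>\<^sub>1\<close>.\<close>

definition rho :: "('a \<Rightarrow> 'n::finite oper) \<Rightarrow> ('a list \<Rightarrow>\<^sub>0 complex) \<Rightarrow> 'n oper"
  where "rho E u p = lin_ext (\<lambda>w. fold E w p) u"

text \<open>\<open>join F Ps\<close> is the operator attached to the forest \<open>F\<close>, given the multiset \<open>Ps\<close> of the
  operators attached to its trees. It does not depend on the enumeration of \<open>Ps\<close>; see
  \<open>rho_lt_forest_empty\<close>, \<open>rho_lt_tree_eq\<close>, \<open>rho_lt_forest_single\<close> and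
  \<open>rho_lt_forest_mset\<close> for the resulting recursion.\<close>

definition join_list :: "'n::finite oper list \<Rightarrow> 'n oper"
  where "join_list Ps u =
    (\<Sum>is | length is = length Ps. (\<Prod>k<length Ps. (Ps ! k) (X (is ! k))) * pds is u)"

definition join :: "'a forest \<Rightarrow> 'n::finite oper multiset \<Rightarrow> 'n oper"
  where "join F Ps u =
    smul (1 / (\<Prod>T\<in>set_mset F. fact (count F T))) (join_list (SOME Qs. mset Qs = Ps) u)"

primrec rho_lt_tree :: "('a \<Rightarrow> 'n::finite oper) \<Rightarrow> 'a tree \<Rightarrow> 'n oper"
  where "rho_lt_tree E (Node \<eta> F) =
    (\<lambda>u. \<Sum>i\<in>UNIV. join F (image_mset (rho_lt_tree E) F) (rho E (basis [\<eta>]) (X i)) * pd i u)"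

definition rho_lt_forest :: "('a \<Rightarrow> 'n::finite oper) \<Rightarrow> 'a forest \<Rightarrow> 'n oper"
  where "rho_lt_forest E F = join F (image_mset (rho_lt_tree E) F)"

definition rho_lt :: "('a \<Rightarrow> 'n::finite oper) \<Rightarrow> ('a forest \<Rightarrow>\<^sub>0 complex) \<Rightarrow> 'n oper"
  where "rho_lt E f p = lin_ext (\<lambda>F. rho_lt_forest E F p) f"

section \<open>Well-definedness and characteristic properties\<close>

lemma lookup_basis: "Poly_Mapping.lookup (basis k) j = (if k = j then 1 else 0)"
  by (simp add: basis_def lookup_single when_def)

lemma keys_basis [simp]: "Poly_Mapping.keys (basis k) = {k}"
  by (simp add: basis_def)

lemma lookup_smul [simp]: "Poly_Mapping.lookup (smul c u) k = c * Poly_Mapping.lookup u k"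
  unfolding smul_def by transfer (simp add: when_def)

lemma smul_simps [simp]:
  "smul c 0 = 0" "smul 0 u = 0" "smul 1 u = u" "smul c (smul d u) = smul (c * d) u"
  "smul c (u + v) = smul c u + smul c v"
  by (auto intro!: poly_mapping_eqI simp: lookup_add algebra_simps)

lemma smul_sum: "smul c (sum f S) = (\<Sum>k\<in>S. smul c (f k))"
  by (rule poly_mapping_eqI) (simp add: lookup_sum sum_distrib_left)

lemma lin_ext_superset:
  assumes "finite S" "Poly_Mapping.keys u \<subseteq> S"
  shows "lin_ext f u = (\<Sum>k\<in>S. smul (Poly_Mapping.lookup u k) (f k))"
  unfolding lin_ext_def using assms
  by (intro sum.mono_neutral_left) (auto simp: in_keys_iff)

lemma lin_ext_basis [simp]: "lin_ext f (basis k) = f k"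
  by (simp add: lin_ext_def lookup_basis)

lemma lin_ext_0 [simp]: "lin_ext f 0 = 0"
  by (simp add: lin_ext_def)

lemma smul_add_left: "smul (c + d) u = smul c u + smul d u"
  by (rule poly_mapping_eqI) (simp add: lookup_add algebra_simps)

lemma lin_ext_add [simp]: "lin_ext f (u + v) = lin_ext f u + lin_ext f v"
proof -
  let ?S = "Poly_Mapping.keys u \<union> Poly_Mapping.keys v"
  show ?thesis
    using keys_add[of u v]
    by (simp add: lin_ext_superset[of ?S] lookup_add smul_add_left sum.distrib)
qed

lemma keys_smul: "Poly_Mapping.keys (smul c u) \<subseteq> Poly_Mapping.keys u"
  by (auto simp: in_keys_iff)

lemma lin_ext_smul [simp]: "lin_ext f (smul c u) = smul c (lin_ext f u)"
  by (simp add: lin_ext_superset[of "Poly_Mapping.keys u"] keys_smul smul_sum)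

lemma lin_ext_add_fun: "lin_ext (\<lambda>k. f k + g k) u = lin_ext f u + lin_ext g u"
  by (simp add: lin_ext_def sum.distrib)

lemma lin_ext_smul_fun: "lin_ext (\<lambda>k. smul c (f k)) u = smul c (lin_ext f u)"
  by (simp add: lin_ext_def smul_sum mult.commute)

lemma lin_ext_basis_id [simp]: "lin_ext basis u = u"
proof (rule poly_mapping_eqI)
  fix k
  have "Poly_Mapping.lookup (lin_ext basis u) k =
    (\<Sum>j\<in>Poly_Mapping.keys u. if j = k then Poly_Mapping.lookup u j else 0)"
    unfolding lin_ext_def lookup_sum by (intro sum.cong) (auto simp: lookup_basis)
  also have "\<dots> = Poly_Mapping.lookup u k"
    by (simp add: in_keys_iff)
  finally show "Poly_Mapping.lookup (lin_ext basis u) k = Poly_Mapping.lookup u k" .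
qed

lemma span_induct [consumes 1, case_names zero add]:
  assumes u: "u \<in> linear_span S"
    and z: "P 0"
    and a: "\<And>c k u. k \<in> S \<Longrightarrow> u \<in> linear_span S \<Longrightarrow> P u \<Longrightarrow> P (smul c (basis k) + u)"
  shows "P u"
proof -
  have "P (\<Sum>k\<in>K. smul (Poly_Mapping.lookup u k) (basis k)) \<and>
      (\<Sum>k\<in>K. smul (Poly_Mapping.lookup u k) (basis k)) \<in> linear_span S"
    if "finite K" "K \<subseteq> S" for K
    using that
  proof (induction K rule: finite_induct)
    case empty
    then show ?case by (simp add: z linear_span_def)
  next
    case (insert k K)
    let ?v = "\<Sum>k\<in>K. smul (Poly_Mapping.lookup u k) (basis k)"
    have "Poly_Mapping.keys (smul (Poly_Mapping.lookup u k) (basis k) + ?v) \<subseteq>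
        {k} \<union> Poly_Mapping.keys ?v"
      using keys_add keys_smul[of _ "basis k"] by fastforce
    then show ?case using insert a[of k ?v] by (auto simp: linear_span_def)
  qed
  from this[of "Poly_Mapping.keys u"] u show ?thesis
    by (simp add: linear_span_def lin_ext_def[symmetric])
qed

lemma basis_in_span [simp]: "k \<in> S \<Longrightarrow> basis k \<in> linear_span S"
  by (simp add: linear_span_def)

lemma span_add: "u \<in> linear_span S \<Longrightarrow> v \<in> linear_span S \<Longrightarrow> u + v \<in> linear_span S"
  using keys_add[of u v] by (auto simp: linear_span_def)

lemma span_smul: "u \<in> linear_span S \<Longrightarrow> smul c u \<in> linear_span S"
  using keys_smul[of c u] by (auto simp: linear_span_def)

lemma span_lin_ext:
  assumes "u \<in> linear_span S" "\<And>k. k \<in> S \<Longrightarrow> f k \<in> linear_span R"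
  shows "lin_ext f u \<in> linear_span R"
  using assms(1)
proof (induction rule: span_induct)
  case zero
  show ?case by (simp add: linear_span_def)
qed (simp add: assms(2) span_add span_smul)

lemma span_bilin_ext:
  assumes "u \<in> linear_span S" "v \<in> linear_span S"
    "\<And>k l. k \<in> S \<Longrightarrow> l \<in> S \<Longrightarrow> f k l \<in> linear_span R"
  shows "bilin_ext f u v \<in> linear_span R"
  unfolding bilin_ext_def using assms by (intro span_lin_ext)

lemma bilin_ext_simps [simp]:
  "bilin_ext f (basis k) (basis l) = f k l"
  "bilin_ext f 0 v = 0" "bilin_ext f u 0 = 0"
  "bilin_ext f (u + u') v = bilin_ext f u v + bilin_ext f u' v"
  "bilin_ext f u (v + v') = bilin_ext f u v + bilin_ext f u v'"
  "bilin_ext f (smul c u) v = smul c (bilin_ext f u v)"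
  "bilin_ext f u (smul c v) = smul c (bilin_ext f u v)"
  unfolding bilin_ext_def
  by (simp_all add: lin_ext_add_fun lin_ext_smul_fun) (simp add: lin_ext_def)

lemma pairing_superset:
  assumes "finite S" "Poly_Mapping.keys u \<subseteq> S"
  shows "pairing u v = (\<Sum>k\<in>S. Poly_Mapping.lookup u k * Poly_Mapping.lookup v k)"
  unfolding pairing_def using assms
  by (intro sum.mono_neutral_left) (auto simp: in_keys_iff)

lemma pairing_basis: "pairing (basis k) v = Poly_Mapping.lookup v k"
  by (simp add: pairing_def lookup_basis)

lemma pairing_basis_right: "pairing u (basis k) = Poly_Mapping.lookup u k"
proof -
  have "pairing u (basis k) =
    (\<Sum>j\<in>Poly_Mapping.keys u. if k = j then Poly_Mapping.lookup u j else 0)"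
    unfolding pairing_def by (intro sum.cong) (auto simp: lookup_basis)
  then show ?thesis by (simp add: in_keys_iff)
qed

lemma pairing_right [simp]:
  "pairing u 0 = 0" "pairing u (v + w) = pairing u v + pairing u w"
  "pairing u (smul c v) = c * pairing u v"
  by (simp_all add: pairing_def lookup_add algebra_simps sum.distrib sum_distrib_left)

lemma gr_add [simp]: "gr (\<eta> + \<theta>) = gr \<eta> + gr \<theta>"
  by (simp add: gr_def sum.distrib)

lemma gr_axis [simp]: "gr (axis i 1) = 1"
  by (simp add: gr_def axis_def)

lemma gr_0 [simp]: "gr 0 = 0"
  by (simp add: gr_def)

lemma Hi_iff: "\<eta> \<in> Hi i \<longleftrightarrow> (\<forall>j. (if j = i then -1 else 0) \<le> \<eta> $ j) \<and> 1 \<le> gr \<eta>"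
proof
  assume "\<eta> \<in> Hi i"
  then obtain n where n: "\<eta> = n - axis i 1" "\<forall>j. 0 \<le> n $ j" "2 \<le> gr n"
    by (auto simp: Hi_def)
  have "n = \<eta> + axis i 1" using n(1) by simp
  then have "gr n = gr \<eta> + 1" by simp
  moreover have "(if j = i then -1 else 0) \<le> \<eta> $ j" for j
    using n(2)[rule_format, of j] by (cases "j = i") (auto simp: n(1) axis_def)
  ultimately show "(\<forall>j. (if j = i then -1 else 0) \<le> \<eta> $ j) \<and> 1 \<le> gr \<eta>"
    using n(3) by simp
next
  assume *: "(\<forall>j. (if j = i then -1 else 0) \<le> \<eta> $ j) \<and> 1 \<le> gr \<eta>"
  have "\<forall>j. 0 \<le> (\<eta> + axis i 1) $ j"
  proof
    fix j show "0 \<le> (\<eta> + axis i 1) $ j" using *[THEN conjunct1, rule_format, of j]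
      by (auto simp: axis_def split: if_splits)
  qed
  then show "\<eta> \<in> Hi i" using * unfolding Hi_def by (auto intro!: exI[of _ "\<eta> + axis i 1"])
qed

lemma gr_H: "\<eta> \<in> H \<Longrightarrow> 1 \<le> gr \<eta>"
  by (auto simp: H_def Hi_iff)

lemma finite_H_le: "finite {\<eta> \<in> H. gr (\<eta> :: int ^ 'n::finite) \<le> N}"
proof -
  let ?b = "N + int CARD('n)"
  let ?V = "(vec_lambda :: ('n \<Rightarrow> int) \<Rightarrow> int ^ 'n) ` (UNIV \<rightarrow>\<^sub>E {-1..?b})"
  have "\<eta> \<in> ?V" if "\<eta> \<in> H" "gr \<eta> \<le> N" for \<eta> :: "int ^ 'n"
  proof -
    from that obtain i where "\<eta> \<in> Hi i" by (auto simp: H_def)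
    then have *: "(if j = i then -1 else 0) \<le> \<eta> $ j" for j
      by (simp add: Hi_iff)
    have lo: "-1 \<le> \<eta> $ j" for j
      using *[of j] by (simp split: if_splits)
    have hi: "\<eta> $ j \<le> ?b" for j
    proof -
      have nonneg: "0 \<le> \<eta> $ k + 1" for k
        using lo[of k] by linarith
      have "\<eta> $ j + 1 \<le> (\<Sum>k\<in>UNIV. \<eta> $ k + 1)"
        by (rule member_le_sum[where f = "\<lambda>k. \<eta> $ k + 1"]) (auto simp: nonneg)
      also have "\<dots> = gr \<eta> + int CARD('n)" by (simp add: gr_def sum.distrib)
      finally show ?thesis using that by auto
    qed
    have "vec_nth \<eta> \<in> UNIV \<rightarrow>\<^sub>E {-1..?b}" using lo hi by auto
    then show ?thesis by (metis imageI vec_nth_inverse)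
  qed
  moreover have "finite ?V" by (intro finite_imageI finite_PiE) auto
  ultimately show ?thesis by (auto intro: finite_subset)
qed

definition is_arborification ::
  "'a set \<Rightarrow> (('a list \<Rightarrow>\<^sub>0 complex) \<Rightarrow> ('a list \<Rightarrow>\<^sub>0 complex) \<Rightarrow> ('a list \<Rightarrow>\<^sub>0 complex)) \<Rightarrow>
    (('a forest \<Rightarrow>\<^sub>0 complex) \<Rightarrow> ('a list \<Rightarrow>\<^sub>0 complex)) \<Rightarrow> bool"
  where "is_arborification A M \<alpha> \<longleftrightarrow>
    (\<forall>u\<in>CK A. \<forall>v\<in>CK A. \<alpha> (u + v) = \<alpha> u + \<alpha> v) \<and>
    (\<forall>c. \<forall>u\<in>CK A. \<alpha> (smul c u) = smul c (\<alpha> u)) \<and>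
    \<alpha> (basis {#}) = basis [] \<and>
    (\<forall>u\<in>CK A. \<forall>v\<in>CK A. \<alpha> (u * v) = M (\<alpha> u) (\<alpha> v)) \<and>
    (\<forall>a\<in>A. \<forall>u\<in>CK A. \<alpha> (Bplus a u) = Lplus a (\<alpha> u))"

lemma Lplus_simps [simp]:
  "Lplus a 0 = 0" "Lplus a (u + v) = Lplus a u + Lplus a v"
  "Lplus a (smul c u) = smul c (Lplus a u)" "Lplus a (basis w) = basis (a # w)"
  by (simp_all add: Lplus_def)

lemma Bplus_simps [simp]:
  "Bplus a 0 = 0" "Bplus a (u + v) = Bplus a u + Bplus a v"
  "Bplus a (smul c u) = smul c (Bplus a u)" "Bplus a (basis F) = basis {#Node a F#}"
  by (simp_all add: Bplus_def)

lemma arbo_simps [simp]: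
  "arbo M 0 = 0" "arbo M (u + v) = arbo M u + arbo M v"
  "arbo M (smul c u) = smul c (arbo M u)" "arbo M (basis F) = arbo_forest M F"
  by (simp_all add: arbo_def)

lemma basis_mult: "basis F * basis G = basis (F + G)"
  by (simp add: basis_def mult_single)

lemma smul_mult [simp]: "smul c p * q = smul c (p * q)" "p * smul c q = smul c (p * q)"
  for p q :: "'b::comm_monoid_add \<Rightarrow>\<^sub>0 complex"
  unfolding smul_def mult_map_scale_conv_mult by (simp_all add: ac_simps)

text \<open>Common generalization of the two products: \<open>q = 0\<close> is the shuffle and \<open>q = 1\<close> the
  quasishuffle.\<close>

fun qsh :: "complex \<Rightarrow> 'a::ab_semigroup_add list \<Rightarrow> 'a list \<Rightarrow> ('a list \<Rightarrow>\<^sub>0 complex)"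
  where
    "qsh q [] v = basis v"
  | "qsh q w [] = basis w"
  | "qsh q (a # w) (b # v) =
      Lplus a (qsh q w (b # v)) + Lplus b (qsh q (a # w) v) + smul q (Lplus (a + b) (qsh q w v))"

abbreviation qM :: "complex \<Rightarrow> ('a::ab_semigroup_add list \<Rightarrow>\<^sub>0 complex) \<Rightarrow>
    ('a list \<Rightarrow>\<^sub>0 complex) \<Rightarrow> ('a list \<Rightarrow>\<^sub>0 complex)"
  where "qM q \<equiv> bilin_ext (qsh q)"

lemma qsh_Nil_right [simp]: "qsh q w [] = basis w"
  by (cases w) simp_all

lemma shuffle_qsh: "shuffle w v = qsh 0 w v"
  by (induction w v rule: shuffle.induct) simp_all

lemma quasishuffle_qsh: "quasishuffle w v = qsh 1 w v"
  by (induction w v rule: quasishuffle.induct) simp_all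

lemma sh_mult_qM: "sh_mult = qM 0"
proof -
  have "shuffle = (qsh 0 :: 'a list \<Rightarrow> _)" by (intro ext shuffle_qsh)
  then show ?thesis by (simp add: sh_mult_def)
qed

lemma qsh_mult_qM: "qsh_mult = qM 1"
proof -
  have "quasishuffle = (qsh 1 :: 'a list \<Rightarrow> _)" by (intro ext quasishuffle_qsh)
  then show ?thesis by (simp add: qsh_mult_def)
qed

lemma in_span_UNIV: "u \<in> linear_span UNIV"
  by (simp add: linear_span_def)

lemma qM_one [simp]: "qM q (basis []) u = u" "qM q u (basis []) = u"
  by (induction rule: span_induct[OF in_span_UNIV[of u]]) simp_all

lemma qM_Lplus:
  "qM q (Lplus a u) (Lplus b v) =
    Lplus a (qM q u (Lplus b v)) + Lplus b (qM q (Lplus a u) v) + smul q (Lplus (a + b) (qM q u v))"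
proof (induction rule: span_induct[OF in_span_UNIV[of u]])
  case (2 c w u)
  have "qM q (basis (a # w)) (Lplus b v) =
    Lplus a (qM q (basis w) (Lplus b v)) + Lplus b (qM q (basis (a # w)) v)
      + smul q (Lplus (a + b) (qM q (basis w) v))"
    by (induction rule: span_induct[OF in_span_UNIV[of v]]) (simp_all add: algebra_simps)
  then show ?case using 2 by (simp add: algebra_simps)
qed simp

lemma qsh_commute: "qsh q w v = qsh q v w"
  by (induction q w v rule: qsh.induct) (simp_all add: algebra_simps)

lemma qM_commute: "qM q u v = qM q v u"
proof (induction rule: span_induct[OF in_span_UNIV[of u]])
  case (2 c w u)
  have "qM q (basis w) v = qM q v (basis w)"
    by (induction rule: span_induct[OF in_span_UNIV[of v]]) (simp_all add: qsh_commute)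
  then show ?case using 2 by simp
qed simp

lemma qsh_assoc: "qM q (qsh q x y) (basis z) = qM q (basis x) (qsh q y z)"
proof (induction "length x + length y + length z" arbitrary: x y z rule: less_induct)
  case less
  show ?case
  proof (cases "x = [] \<or> y = [] \<or> z = []")
    case True
    then show ?thesis by auto
  next
    case False
    then obtain a x' b y' c z' where [simp]: "x = a # x'" "y = b # y'" "z = c # z'"
      by (meson list.exhaust)
    have L: "qM q (Lplus a' u) (basis (b' # v)) =
        Lplus a' (qM q u (basis (b' # v))) + Lplus b' (qM q (Lplus a' u) (basis v))
        + smul q (Lplus (a' + b') (qM q u (basis v)))" for a' b' u v
      using qM_Lplus[of q a' u b' "basis v"] by simp
    have R: "qM q (basis (a' # u)) (Lplus b' v) =
        Lplus a' (qM q (basis u) (Lplus b' v)) + Lplus b' (qM q (basis (a' # u)) v)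
        + smul q (Lplus (a' + b') (qM q (basis u) v))" for a' b' u v
      using qM_Lplus[of q a' "basis u" b' v] by simp
    have IH: "qM q (qsh q x'' y'') (basis z'') = qM q (basis x'') (qsh q y'' z'')"
      if "length x'' + length y'' + length z'' < length x + length y + length z" for x'' y'' z'' :: "'a list"
      using that by (rule less)
    note I = IH[of x' y z] IH[of x y' z] IH[of x y z'] IH[of x' y' z] IH[of x' y z']
      IH[of x y' z'] IH[of x' y' z']
    have "qM q (qsh q x y) (basis z) =
       Lplus a (qM q (qsh q x' y) (basis z)) + Lplus b (qM q (qsh q x y') (basis z))
       + smul q (Lplus (a + b) (qM q (qsh q x' y') (basis z)))
       + Lplus c (qM q (qsh q x y) (basis z'))
       + smul q (Lplus (a + c) (qM q (qsh q x' y) (basis z')))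
       + smul q (Lplus (b + c) (qM q (qsh q x y') (basis z')))
       + smul (q * q) (Lplus (a + b + c) (qM q (qsh q x' y') (basis z')))"
      by (simp add: L algebra_simps)
    also have "\<dots> =
       Lplus a (qM q (basis x') (qsh q y z)) + Lplus b (qM q (basis x) (qsh q y' z))
       + smul q (Lplus (a + b) (qM q (basis x') (qsh q y' z)))
       + Lplus c (qM q (basis x) (qsh q y z'))
       + smul q (Lplus (a + c) (qM q (basis x') (qsh q y z')))
       + smul q (Lplus (b + c) (qM q (basis x) (qsh q y' z')))
       + smul (q * q) (Lplus (a + b + c) (qM q (basis x') (qsh q y' z')))"
      using I by simp
    also have "\<dots> = qM q (basis x) (qsh q y z)"
      by (simp add: R algebra_simps)
    finally show ?thesis .
  qed
qed

lemma qM_assoc: "qM q (qM q u v) w = qM q u (qM q v w)"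
proof (induction rule: span_induct[OF in_span_UNIV[of u]])
  case (2 c x u)
  have "qM q (qM q (basis x) v) w = qM q (basis x) (qM q v w)"
  proof (induction rule: span_induct[OF in_span_UNIV[of v]])
    case (2 d y v)
    have "qM q (qsh q x y) w = qM q (basis x) (qM q (basis y) w)"
      by (induction rule: span_induct[OF in_span_UNIV[of w]]) (simp_all add: qsh_assoc)
    then show ?case using 2 by simp
  qed simp
  then show ?case using 2 by simp
qed simp

lemma arbo_forest_single: "arbo_forest M {#Node a F#} = M (Lplus a (arbo_forest M F)) (basis [])"
  by (simp add: arbo_forest_def)

lemma comp_fun_commute_qM: "comp_fun_commute (qM q)"
proof
  fix u v :: "'a list \<Rightarrow>\<^sub>0 complex"
  have "qM q v (qM q u w) = qM q u (qM q v w)" for w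
    using qM_commute[of q u v] by (simp add: qM_assoc[symmetric])
  then show "qM q v \<circ> qM q u = qM q u \<circ> qM q v" by (simp add: fun_eq_iff)
qed

lemma arbo_forest_union:
  "arbo_forest (qM q) (F + G) = qM q (arbo_forest (qM q) F) (arbo_forest (qM q) G)"
proof -
  interpret comp_fun_commute "qM q" by (rule comp_fun_commute_qM)
  show ?thesis
    by (induction F) (simp_all add: arbo_forest_def qM_assoc)
qed

lemma arbo_qM: "is_arborification A (qM q) (arbo (qM q))"
proof -
  have mult: "arbo (qM q) (u * v) = qM q (arbo (qM q) u) (arbo (qM q) v)" for u v
  proof (induction rule: span_induct[OF in_span_UNIV[of u]])
    case (2 c F u)
    have "arbo (qM q) (basis F * v) = qM q (arbo_forest (qM q) F) (arbo (qM q) v)"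
      by (induction rule: span_induct[OF in_span_UNIV[of v]])
        (simp_all add: distrib_left basis_mult arbo_forest_union)
    then show ?case using 2 by (simp add: distrib_right)
  qed simp
  have graft: "arbo (qM q) (Bplus a u) = Lplus a (arbo (qM q) u)" for a u
    by (induction rule: span_induct[OF in_span_UNIV[of u]]) (simp_all add: arbo_forest_single)
  have one: "arbo (qM q) (basis {#}) = basis []"
    by (simp add: arbo_forest_def)
  show ?thesis
    unfolding is_arborification_def mult graft one by simp
qed

lemma arbo_sh: "is_arborification A sh_mult (arbo sh_mult)"
  for A :: "'a::ab_semigroup_add set"
  unfolding sh_mult_qM by (rule arbo_qM)

lemma arbo_qsh: "is_arborification A qsh_mult (arbo qsh_mult)"
  for A :: "'a::ab_semigroup_add set"
  unfolding qsh_mult_qM by (rule arbo_qM)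

lemma forests_simps [simp]:
  "{#} \<in> forests A"
  "add_mset (Node a F) G \<in> forests A \<longleftrightarrow> a \<in> A \<and> F \<in> forests A \<and> G \<in> forests A"
  by (auto simp: forests_def)

lemma forest_induct [consumes 1, case_names empty graft]:
  assumes "F \<in> forests A"
    and "P {#}"
    and "\<And>a F G. a \<in> A \<Longrightarrow> F \<in> forests A \<Longrightarrow> G \<in> forests A \<Longrightarrow> P F \<Longrightarrow> P G \<Longrightarrow>
      P (add_mset (Node a F) G)"
  shows "P F"
proof -
  have step: "P F" if "\<And>T. T \<in># F \<Longrightarrow> \<exists>a G. T = Node a G \<and> P G" "F \<in> forests A" for F
    using that
  proof (induction F)
    case (add T F)
    have "T \<in># add_mset T F" by simp
    from add.prems(1)[OF this] obtain a G where T: "T = Node a G" "P G" by (elim exE conjE)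
    have "P F"
    proof (rule add.IH)
      show "\<exists>a G. T' = Node a G \<and> P G" if "T' \<in># F" for T'
        using add.prems(1)[of T'] that by simp
      show "F \<in> forests A" using add.prems(2) by (simp add: forests_def)
    qed
    moreover have "a \<in> A" "G \<in> forests A" "F \<in> forests A"
      using add.prems(2) by (auto simp: T(1) forests_def)
    ultimately show ?case unfolding T(1) using T(2) by (intro assms(3))
  qed (rule assms)
  have "{#T#} \<in> forests A \<Longrightarrow> \<exists>a G. T = Node a G \<and> P G" for T
  proof (induction T)
    case (Node a G)
    have "P G"
    proof (rule step)
      show G: "G \<in> forests A" using Node.prems by simp
      show "\<exists>a G. T = Node a G \<and> P G" if "T \<in># G" for T
      proof (rule Node.IH[OF that])
        show "{#T#} \<in> forests A" using G that by (simp add: forests_def)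
      qed
    qed
    then show ?case by simp
  qed
  then have "\<exists>a G. T = Node a G \<and> P G" if "T \<in># F" for T
    using assms(1) that by (simp add: forests_def)
  then show ?thesis using assms(1) by (rule step)
qed

lemma arbo_unique:
  assumes \<alpha>: "is_arborification A M \<alpha>" and \<beta>: "is_arborification A M \<beta>" and u: "u \<in> CK A"
  shows "\<alpha> u = \<beta> u"
proof -
  have F: "\<alpha> (basis F) = \<beta> (basis F)" if "F \<in> forests A" for F
    using that
  proof (induction rule: forest_induct)
    case empty
    then show ?case using \<alpha> \<beta> by (simp add: is_arborification_def)
  next
    case (graft a F G)
    have eq: "basis (add_mset (Node a F) G) = Bplus a (basis F) * basis G"
      by (simp add: basis_mult)
    have "basis F \<in> CK A" "basis G \<in> CK A" "Bplus a (basis F) \<in> CK A"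
      using graft by (simp_all add: CK_def)
    then show ?case using graft \<alpha> \<beta> unfolding eq is_arborification_def by metis
  qed
  have zero: "\<gamma> 0 = 0" if "is_arborification A M \<gamma>" for \<gamma>
  proof -
    have "(0 :: 'a forest \<Rightarrow>\<^sub>0 complex) \<in> CK A" by (simp add: CK_def linear_span_def)
    then have "\<gamma> (smul 0 0) = smul 0 (\<gamma> 0)"
      using that unfolding is_arborification_def by blast
    then show ?thesis by simp
  qed
  show ?thesis using u unfolding CK_def
  proof (induction rule: span_induct)
    case (add c F u)
    then have "basis F \<in> CK A" "u \<in> CK A" "smul c (basis F) \<in> CK A"
      by (simp_all add: CK_def span_smul)
    then show ?case using \<alpha> \<beta> F[OF add(1)] add unfolding is_arborification_def by metis
  qed (simp add: zero[OF \<alpha>] zero[OF \<beta>])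
qed

lemma qsh_Conc:
  assumes "q = 0 \<or> (\<forall>a\<in>A. \<forall>b\<in>A. a + b \<in> A)" "w \<in> lists A" "v \<in> lists A"
  shows "qsh q w v \<in> Conc A"
  using assms
proof (induction q w v rule: qsh.induct)
  case (3 q a w b v)
  have L: "Lplus c u \<in> linear_span (lists A)" if "c \<in> A" "u \<in> linear_span (lists A)" for c u
    unfolding Lplus_def using that by (intro span_lin_ext[where S = "lists A"]) simp_all
  show ?case
  proof (cases "q = 0")
    case True
    then show ?thesis using 3 by (simp add: Conc_def span_add L)
  next
    case False
    then have "a + b \<in> A" using 3 by simp
    then show ?thesis using 3 by (simp add: Conc_def span_add span_smul L)
  qed
qed (simp_all add: Conc_def)

lemma arbo_forest_add_mset:
  "arbo_forest (qM q) (add_mset (Node a F) G) =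
    qM q (Lplus a (arbo_forest (qM q) F)) (arbo_forest (qM q) G)"
  using arbo_forest_union[of q "{#Node a F#}" G] by (simp add: arbo_forest_single)

lemma arbo_qM_Conc:
  assumes q: "q = 0 \<or> (\<forall>a\<in>A. \<forall>b\<in>A. a + b \<in> A)" and "B \<subseteq> A" and u: "u \<in> CK B"
  shows "arbo (qM q) u \<in> Conc A"
proof -
  have "arbo_forest (qM q) F \<in> linear_span (lists A)" if "F \<in> forests B" for F
    using that
  proof (induction rule: forest_induct)
    case empty
    then show ?case by (simp add: arbo_forest_def)
  next
    case (graft a F G)
    have "Lplus a (arbo_forest (qM q) F) \<in> linear_span (lists A)"
      unfolding Lplus_def using graft(4) subsetD[OF \<open>B \<subseteq> A\<close> graft(1)]
      by (intro span_lin_ext[where S = "lists A"]) simp_all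
    then show ?case unfolding arbo_forest_add_mset
      using graft(5) qsh_Conc[OF q, unfolded Conc_def]
      by (intro span_bilin_ext[where S = "lists A"])
  qed
  then show ?thesis using u
    unfolding arbo_def CK_def Conc_def by (intro span_lin_ext)
qed

lemma arbo_sh_Conc: "u \<in> CK H \<Longrightarrow> arbo sh_mult u \<in> Conc H"
  unfolding sh_mult_qM by (rule arbo_qM_Conc) simp_all

lemma arbo_qsh_Conc: "u \<in> CK H \<Longrightarrow> arbo qsh_mult u \<in> Conc Hbar"
  unfolding qsh_mult_qM by (rule arbo_qM_Conc[where B = H]) (auto intro: Hbar.intros)

primrec tree_sum :: "'a::comm_monoid_add tree \<Rightarrow> 'a"
  where "tree_sum (Node a F) = a + sum_mset (image_mset tree_sum F)"

definition forest_sum :: "'a::comm_monoid_add forest \<Rightarrow> 'a"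
  where "forest_sum F = sum_mset (image_mset tree_sum F)"

lemma forest_sum_simps [simp]:
  "forest_sum {#} = 0" "forest_sum (add_mset T F) = tree_sum T + forest_sum F"
  "tree_sum (Node a F) = a + forest_sum F"
  by (simp_all add: forest_sum_def)

declare tree_sum.simps [simp del]

lemma qsh_homogeneous: "qsh q w v \<in> linear_span {x. sum_list x = sum_list w + sum_list v}"
  for w v :: "'a::comm_monoid_add list"
proof (induction q w v rule: qsh.induct)
  case (3 q a w b v)
  have L: "Lplus c u \<in> linear_span {x. sum_list x = s}"
    if "u \<in> linear_span {x. sum_list x = t}" "s = c + t" for c s t :: 'a and u
    unfolding Lplus_def using that
    by (intro span_lin_ext[where S = "{x. sum_list x = t}"]) simp_all
  show ?case unfolding qsh.simps
    by (intro span_add span_smul L[OF 3(1)] L[OF 3(2)] L[OF 3(3)]) (simp_all add: ac_simps)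
qed simp_all

lemma arbo_forest_homogeneous: "arbo_forest (qM q) F \<in> linear_span {w. sum_list w = forest_sum F}"
proof -
  have "F \<in> forests UNIV" by (simp add: forests_def)
  then show ?thesis
  proof (induction rule: forest_induct)
    case empty
    then show ?case by (simp add: arbo_forest_def)
  next
    case (graft a F G)
    let ?S = "\<lambda>s. linear_span {w. sum_list w = s}"
    have L: "Lplus a (arbo_forest (qM q) F) \<in> ?S (a + forest_sum F)"
      unfolding Lplus_def using graft(4)
      by (intro span_lin_ext[where S = "{w. sum_list w = forest_sum F}"]) simp_all
    have "lin_ext (\<lambda>w. lin_ext (qsh q w) (arbo_forest (qM q) G)) (Lplus a (arbo_forest (qM q) F))
        \<in> ?S (a + forest_sum F + forest_sum G)"
    proof (rule span_lin_ext[OF L], rule span_lin_ext[OF graft(5)])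
      fix w v :: "'a list"
      assume "w \<in> {w. sum_list w = a + forest_sum F}" "v \<in> {w. sum_list w = forest_sum G}"
      then show "qsh q w v \<in> ?S (a + forest_sum F + forest_sum G)"
        using qsh_homogeneous[of q w v] by simp
    qed
    then show ?case unfolding arbo_forest_add_mset by (simp add: bilin_ext_def)
  qed
qed

lemma gr_forest_sum: "F \<in> forests H \<Longrightarrow> int (size F) \<le> gr (forest_sum F)"
proof (induction rule: forest_induct)
  case (graft a F G)
  then show ?case using gr_H[of a] by simp
qed simp

lemma gr_tree_sum_le:
  assumes "F \<in> forests H" "T \<in># F"
  shows "gr (tree_sum T) \<le> gr (forest_sum F)"
proof -
  obtain G where G: "F = add_mset T G" using assms(2) by (metis insert_DiffM)
  then have "G \<in> forests H" using assms(1) by (simp add: forests_def)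
  then show ?thesis using gr_forest_sum[of G] by (simp add: G)
qed

lemma finite_forests_gr_le:
  "finite {F \<in> forests H. gr (forest_sum F :: int ^ 'n::finite) \<le> int n}"
proof (induction n)
  case 0
  have "{F \<in> forests H. gr (forest_sum F :: int ^ 'n) \<le> int 0} \<subseteq> {{#}}"
  proof
    fix F :: "(int ^ 'n) forest" assume "F \<in> {F \<in> forests H. gr (forest_sum F) \<le> int 0}"
    then have "int (size F) \<le> gr (forest_sum F)" "gr (forest_sum F) \<le> 0"
      using gr_forest_sum[of F] by simp_all
    then have "int (size F) \<le> 0" by (rule order_trans)
    then show "F \<in> {{#}}" by simp
  qed
  then show ?case by (rule finite_subset) simp
next
  case (Suc n)
  let ?T = "(\<lambda>(a, F). Node a F) `
    ({a \<in> H. gr (a :: int ^ 'n) \<le> int (Suc n)} \<times> {F \<in> forests H. gr (forest_sum F) \<le> int n})"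
  have "{F \<in> forests H. gr (forest_sum F :: int ^ 'n) \<le> int (Suc n)}
      \<subseteq> mset ` {Ts. set Ts \<subseteq> ?T \<and> length Ts \<le> Suc n}"
  proof
    fix F :: "(int ^ 'n) forest" assume F: "F \<in> {F \<in> forests H. gr (forest_sum F) \<le> int (Suc n)}"
    obtain Ts where Ts: "F = mset Ts" by (metis ex_mset)
    have "int (length Ts) \<le> gr (forest_sum F)" "gr (forest_sum F) \<le> int (Suc n)"
      using gr_forest_sum[of F] F by (simp_all add: Ts)
    then have "length Ts \<le> Suc n" by linarith
    moreover have "T \<in> ?T" if "T \<in> set Ts" for T
    proof -
      obtain a G where T: "T = Node a G" by (cases T)
      have "T \<in># F" using that by (simp add: Ts)
      then have 1: "set_tree T \<subseteq> H" "gr (tree_sum T) \<le> int (Suc n)"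
        using F gr_tree_sum_le[of F T] by (auto simp: forests_def)
      have 2: "a \<in> H" "G \<in> forests H"
        using 1(1) by (auto simp: T forests_def)
      have "gr a \<le> int (Suc n)" "gr (forest_sum G) \<le> int n"
        using 1(2) gr_H[OF 2(1)] gr_forest_sum[OF 2(2)] by (simp_all add: T)
      then show ?thesis using 2 by (auto simp: T)
    qed
    ultimately show "F \<in> mset ` {Ts. set Ts \<subseteq> ?T \<and> length Ts \<le> Suc n}"
      unfolding Ts by blast
  qed
  moreover have "finite (mset ` {Ts. set Ts \<subseteq> ?T \<and> length Ts \<le> Suc n})"
    using Suc finite_H_le by (intro finite_imageI finite_lists_length_le finite_cartesian_product)
  ultimately show ?case by (rule finite_subset)
qed

lemma lookup_graded_dual_qM:
  "Poly_Mapping.lookup (graded_dual H (arbo (qM q)) u) F =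
    (if F \<in> forests H then pairing u (arbo (qM q) (basis F)) else 0)"
proof -
  let ?f = "\<lambda>F. if F \<in> forests H then pairing u (arbo (qM q) (basis F)) else 0"
  have "{F. ?f F \<noteq> 0} \<subseteq>
    (\<Union>w\<in>Poly_Mapping.keys u. {F \<in> forests H. gr (forest_sum F) \<le> int (nat (gr (sum_list w)))})"
  proof
    fix F assume "F \<in> {F. ?f F \<noteq> 0}"
    then have F: "F \<in> forests H" and "pairing u (arbo_forest (qM q) F) \<noteq> 0"
      by (auto split: if_splits)
    then obtain w where w: "w \<in> Poly_Mapping.keys u"
      "Poly_Mapping.lookup u w * Poly_Mapping.lookup (arbo_forest (qM q) F) w \<noteq> 0"
      unfolding pairing_def by (meson sum.not_neutral_contains_not_neutral)
    then have "w \<in> Poly_Mapping.keys (arbo_forest (qM q) F)" by (simp add: in_keys_iff)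
    then have "sum_list w = forest_sum F"
      using arbo_forest_homogeneous[of q F] by (auto simp: linear_span_def)
    then show "F \<in> (\<Union>w\<in>Poly_Mapping.keys u.
        {F \<in> forests H. gr (forest_sum F) \<le> int (nat (gr (sum_list w)))})"
      using w(1) F by force
  qed
  then have "finite {F. ?f F \<noteq> 0}"
    by (rule finite_subset) (intro finite_UN_I finite_keys finite_forests_gr_le)
  then show ?thesis unfolding graded_dual_def by (subst lookup_Abs_poly_mapping) auto
qed

lemma graded_dual_qM:
  "graded_dual H (arbo (qM q)) u \<in> CK H"
  "v \<in> CK H \<Longrightarrow> pairing (graded_dual H (arbo (qM q)) u) v = pairing u (arbo (qM q) v)"
proof -
  show "graded_dual H (arbo (qM q)) u \<in> CK H"
    by (auto simp: CK_def linear_span_def in_keys_iff lookup_graded_dual_qM split: if_splits)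
  show "pairing (graded_dual H (arbo (qM q)) u) v = pairing u (arbo (qM q) v)" if "v \<in> CK H"
    using that unfolding CK_def
    by (induction rule: span_induct) (simp_all add: pairing_basis_right lookup_graded_dual_qM)
qed

lemma graded_dual_arbo_sh:
  "graded_dual H (arbo sh_mult) u \<in> CK H"
  "v \<in> CK H \<Longrightarrow> pairing (graded_dual H (arbo sh_mult) u) v = pairing u (arbo sh_mult v)"
  unfolding sh_mult_qM by (fact graded_dual_qM)+

lemma graded_dual_arbo_qsh:
  "graded_dual H (arbo qsh_mult) u \<in> CK H"
  "v \<in> CK H \<Longrightarrow> pairing (graded_dual H (arbo qsh_mult) u) v = pairing u (arbo qsh_mult v)"
  unfolding qsh_mult_qM by (fact graded_dual_qM)+

lemma finite_decomps: "finite (decomps \<eta>)"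
proof (rule finite_subset)
  let ?A = "{\<theta> \<in> H. gr \<theta> \<le> gr \<eta>}"
  have len: "int (length \<eta>s) \<le> gr (sum_list \<eta>s) \<and> (\<forall>\<theta>\<in>set \<eta>s. gr \<theta> \<le> gr (sum_list \<eta>s))"
    if "set \<eta>s \<subseteq> H" for \<eta>s :: "(int ^ 'a) list"
    using that
  proof (induction \<eta>s)
    case (Cons \<theta> \<eta>s)
    then show ?case using gr_H[of \<theta>] by fastforce
  qed simp
  show "decomps \<eta> \<subseteq> {\<eta>s. set \<eta>s \<subseteq> ?A \<and> length \<eta>s \<le> nat (gr \<eta>)}"
  proof
    fix \<eta>s assume "\<eta>s \<in> decomps \<eta>"
    then show "\<eta>s \<in> {\<eta>s. set \<eta>s \<subseteq> ?A \<and> length \<eta>s \<le> nat (gr \<eta>)}"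
      using len[of \<eta>s] by (auto simp: decomps_def)
  qed
  show "finite {\<eta>s. set \<eta>s \<subseteq> ?A \<and> length \<eta>s \<le> nat (gr \<eta>)}"
    by (intro finite_lists_length_le finite_H_le)
qed

lemma pd_simps [simp]: "pd i 0 = 0" "pd i (u + v) = pd i u + pd i v" "pd i (smul c u) = smul c (pd i u)"
  by (simp_all add: pd_def)

lemma pd_basis: "pd i (basis m) = smul (of_nat (m $ i)) (basis (m - axis i 1))"
  by (simp add: pd_def)

lemma pd_commute: "pd i (pd j u) = pd j (pd i u)"
proof -
  have "u \<in> linear_span UNIV" by (simp add: linear_span_def)
  then show ?thesis
  proof (induction rule: span_induct)
    case (add c m u)
    have eq: "m - axis i 1 - axis j 1 = m - axis j 1 - axis i (1::nat)"
      by (simp add: vec_eq_iff add.commute)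
    have "pd i (pd j (basis m)) = pd j (pd i (basis m))"
    proof (cases "i = j")
      case False
      then have "(m - axis i 1) $ j = m $ j" "(m - axis j 1) $ i = m $ i"
        by (simp_all add: axis_def)
      then show ?thesis by (simp only: pd_basis pd_simps smul_simps eq mult.commute)
    qed simp
    then show ?case using add.IH by simp
  qed simp
qed

lemma pds_mset: "mset is = mset js \<Longrightarrow> pds is = pds js"
proof -
  interpret comp_fun_commute pd
    by unfold_locales (simp add: fun_eq_iff pd_commute)
  have "pds is u = fold_mset pd u (mset is)" for "is" u
    by (induction "is") (simp_all add: pds_def)
  then show "mset is = mset js \<Longrightarrow> pds is = pds js" by (metis ext)
qed

lemma join_list_permute:
  assumes "mset Ps = mset Qs"
  shows "join_list Ps = join_list Qs"
proof
  fix u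
  obtain \<pi> where pi: "\<pi> permutes {..<length Qs}" "permute_list \<pi> Qs = Ps"
    using mset_eq_permutation[OF assms] by blast
  have [simp]: "length Ps = length Qs" using assms by (rule mset_eq_length)
  let ?I = "{is :: 'a list. length is = length Qs}"
  have bij: "bij_betw (permute_list \<pi>) ?I ?I"
  proof (rule bij_betw_byWitness[where f' = "permute_list (inv \<pi>)"])
    have inv: "inv \<pi> permutes {..<length Qs}" using pi(1) by (rule permutes_inv)
    show "\<forall>is\<in>?I. permute_list (inv \<pi>) (permute_list \<pi> is) = is"
      using pi(1) inv by (auto simp: permute_list_compose[symmetric] permutes_inv_o)
    show "\<forall>is\<in>?I. permute_list \<pi> (permute_list (inv \<pi>) is) = is"
      using pi(1) inv by (auto simp: permute_list_compose[symmetric] permutes_inv_o)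
  qed auto
  have "join_list Qs u = (\<Sum>is\<in>?I. (\<Prod>k<length Qs. (Qs ! k) (X (is ! k))) * pds is u)"
    by (simp add: join_list_def)
  also have "\<dots> = (\<Sum>is\<in>?I. (\<Prod>k<length Qs. (Ps ! k) (X (permute_list \<pi> is ! k)))
      * pds (permute_list \<pi> is) u)"
  proof (rule sum.cong)
    fix "is" :: "'a list" assume "is \<in> ?I"
    then have l: "length is = length Qs" by simp
    have "pds (permute_list \<pi> is) = pds is"
      using pi(1) l by (intro pds_mset) simp
    moreover have "(\<Prod>k<length Qs. (Qs ! k) (X (is ! k))) =
      (\<Prod>k<length Qs. (Ps ! k) (X (permute_list \<pi> is ! k)))"
    proof -
      have "(\<Prod>k<length Qs. (Qs ! k) (X (is ! k))) =
        (\<Prod>k<length Qs. (Qs ! \<pi> k) (X (is ! \<pi> k)))"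
        using prod.permute[OF pi(1), of "\<lambda>k. (Qs ! k) (X (is ! k))"] by (simp add: o_def)
      then show ?thesis
        using pi l by (auto simp: permute_list_nth intro!: prod.cong)
    qed
    ultimately show "(\<Prod>k<length Qs. (Qs ! k) (X (is ! k))) * pds is u =
      (\<Prod>k<length Qs. (Ps ! k) (X (permute_list \<pi> is ! k))) * pds (permute_list \<pi> is) u"
      by simp
  qed simp
  also have "\<dots> = (\<Sum>is\<in>?I. (\<Prod>k<length Qs. (Ps ! k) (X (is ! k))) * pds is u)"
    by (rule sum.reindex_bij_betw[OF bij])
  also have "\<dots> = join_list Ps u"
    by (simp add: join_list_def)
  finally show "join_list Ps u = join_list Qs u" by simp
qed

lemma rho_lt_forest_mset:
  "rho_lt_forest E (mset Ts) u =
    smul (1 / (\<Prod>T\<in>set Ts. fact (count (mset Ts) T)))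
      (\<Sum>is | length is = length Ts.
        (\<Prod>k<length Ts. rho_lt_tree E (Ts ! k) (X (is ! k))) * pds is u)"
proof -
  let ?M = "image_mset (rho_lt_tree E) (mset Ts)"
  have "mset (SOME Qs. mset Qs = ?M) = mset (map (rho_lt_tree E) Ts)"
    using someI_ex[OF ex_mset[of ?M]] by simp
  then have "join_list (SOME Qs. mset Qs = ?M) = join_list (map (rho_lt_tree E) Ts)"
    by (rule join_list_permute)
  moreover have "(\<Sum>is | length is = length Ts. (\<Prod>k<length Ts. (map (rho_lt_tree E) Ts ! k) (X (is ! k))) * pds is u) =
      (\<Sum>is | length is = length Ts. (\<Prod>k<length Ts. rho_lt_tree E (Ts ! k) (X (is ! k))) * pds is u)"
    by (intro sum.cong arg_cong2[where f = "(*)"] prod.cong) auto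
  ultimately show ?thesis
    by (simp add: rho_lt_forest_def join_def join_list_def)
qed

lemma rho_lt_forest_empty: "rho_lt_forest E {#} = id"
  using rho_lt_forest_mset[of E "[]"] by (simp add: fun_eq_iff pds_def)

lemma rho_lt_tree_eq:
  "rho_lt_tree E (Node \<eta> F) u =
    (\<Sum>i\<in>UNIV. rho_lt_forest E F (rho E (basis [\<eta>]) (X i)) * pd i u)"
  by (simp add: rho_lt_forest_def)

lemma pd_X: "pd i (X j) = (if i = j then 1 else 0)"
proof -
  have "axis j 1 - axis j 1 = (0 :: nat ^ 'a)" by simp
  then show ?thesis
    by (cases "i = j") (simp_all add: X_def pd_basis, simp_all add: axis_def basis_def)
qed

lemma rho_lt_tree_X: "rho_lt_tree E (Node \<eta> F) (X i) = rho_lt_forest E F (rho E (basis [\<eta>]) (X i))"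
  by (simp add: rho_lt_tree_eq pd_X if_distrib del: rho_lt_tree.simps cong: if_cong)

lemma rho_lt_forest_single: "rho_lt_forest E {#T#} = rho_lt_tree E T"
proof
  fix u
  obtain \<eta> F where T: "T = Node \<eta> F" by (cases T)
  have I: "{is :: 'a list. length is = Suc 0} = (\<lambda>i. [i]) ` UNIV"
    by (auto simp: length_Suc_conv)
  have "rho_lt_forest E {#T#} u =
      (\<Sum>i\<in>UNIV. rho_lt_tree E T (X i) * pd i u)"
    using rho_lt_forest_mset[of E "[T]" u] by (simp add: I sum.reindex inj_on_def pds_def)
  then show "rho_lt_forest E {#T#} u = rho_lt_tree E T u"
    by (simp only: T rho_lt_tree_X) (simp only: rho_lt_tree_eq)
qed

lemma diff_ops_sum:
  "finite S \<Longrightarrow> (\<And>k. k \<in> S \<Longrightarrow> P k \<in> diff_ops) \<Longrightarrow> (\<lambda>u. \<Sum>k\<in>S. P k u) \<in> diff_ops"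
proof (induction S rule: finite_induct)
  case empty
  have "(\<lambda>u. 0 * u) \<in> diff_ops" by (rule mult_op)
  then show ?case by simp
qed (auto intro: add_op)

lemma diff_ops_id: "id \<in> diff_ops"
proof -
  have "(\<lambda>u. 1 * u) \<in> diff_ops" by (rule mult_op)
  then show ?thesis unfolding mult_1_left id_def .
qed

lemma diff_ops_mult: "P \<in> diff_ops \<Longrightarrow> (\<lambda>u. p * P u) \<in> diff_ops"
  using comp_op[OF mult_op] by (simp add: o_def)

lemma diff_ops_smul: "P \<in> diff_ops \<Longrightarrow> (\<lambda>u. smul c (P u)) \<in> diff_ops"
  unfolding smul_def mult_map_scale_conv_mult by (rule diff_ops_mult)

lemma pds_diff_ops: "pds is \<in> diff_ops"
proof (induction "is")
  case Nil
  show ?case using diff_ops_id by (simp add: pds_def id_def)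
next
  case (Cons i "is")
  then have "pd i \<circ> pds is \<in> diff_ops" by (intro comp_op pd_op)
  then show ?case by (simp add: pds_def o_def)
qed

lemma finite_index_lists: "finite {is :: 'n::finite list. length is = s}"
  using finite_lists_length_eq[OF finite_class.finite_UNIV, where n = s] by simp

lemma B_op_diff_ops: "B_op a \<eta> \<in> diff_ops"
  unfolding B_op_def[abs_def]
  by (intro diff_ops_sum diff_ops_smul diff_ops_mult pd_op) simp

lemma D_op_diff_ops: "D_op a \<eta> \<in> diff_ops"
  unfolding D_op_def[abs_def]
  by (intro diff_ops_sum diff_ops_smul diff_ops_mult pds_diff_ops finite_decomps
      finite_index_lists)

lemma fold_diff_ops:
  assumes "\<And>\<eta>. E \<eta> \<in> diff_ops"
  shows "fold E w \<in> diff_ops"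
proof (induction w)
  case Nil
  show ?case using diff_ops_id by (simp add: id_def)
next
  case (Cons \<eta> w)
  then have "fold E w \<circ> E \<eta> \<in> diff_ops" by (intro comp_op assms)
  then show ?case by (simp add: o_def)
qed

lemma rho_diff_ops:
  assumes "\<And>\<eta>. E \<eta> \<in> diff_ops"
  shows "rho E u \<in> diff_ops"
  unfolding rho_def[abs_def] lin_ext_def
  by (intro diff_ops_sum diff_ops_smul fold_diff_ops assms) simp

lemma rho_lt_forest_diff_ops: "rho_lt_forest E F \<in> diff_ops"
proof -
  obtain Ts where F: "F = mset Ts" by (metis ex_mset)
  show ?thesis unfolding F rho_lt_forest_mset[abs_def]
    by (intro diff_ops_sum diff_ops_smul diff_ops_mult pds_diff_ops finite_index_lists)
qed

lemma rho_lt_diff_ops: "rho_lt E f \<in> diff_ops"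
  unfolding rho_lt_def[abs_def] lin_ext_def
  by (intro diff_ops_sum diff_ops_smul rho_lt_forest_diff_ops) simp

end

theory Submission
  imports Defs "HOL-Combinatorics.Multiset_Permutations"
begin

text \<open>
  For a word \<open>w\<close> over \<open>Hbar\<close>, the claim is an equality of two operators on polynomials, and both
  obey the same product rule. The operators of the letters are derivations in the shuffle case
  and, in the quasishuffle case, components of a substitution, so that
  \<open>E \<eta> (p p') = E \<eta> p \<cdot> p' + p \<cdot> E \<eta> p' + q \<Sum>\<^bsub>\<alpha> + \<beta> = \<eta>\<^esub> E \<alpha> p \<cdot> E \<beta> p'\<close> with \<open>q = 0\<close> or \<open>q = 1\<close>.
  Composing along \<open>w\<close>, the value of \<open>\<rho>(w)\<close> on \<open>p p'\<close> is the convolution, dual to the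
  (quasi)shuffle product of words, of \<open>u \<mapsto> \<rho>(u) p\<close> and \<open>u \<mapsto> \<rho>(u) p'\<close> (\<open>fold_mult\<close>).

  On the side of forests, \<open>\<rho>\<^sup><(F)\<close> is a divided power of commuting symbols, in the sense that
  the coefficients of the vector fields of the trees stand to the left of all derivatives. The
  factor \<open>1 / (d\<^sub>1! \<dots> d\<^sub>k!)\<close> is exactly what makes the Leibniz rule
  \<open>\<rho>\<^sup><(F) (p p') = \<Sum>\<^bsub>A + B = F\<^esub> \<rho>\<^sup><(A) p \<cdot> \<rho>\<^sup><(B) p'\<close> hold without multiplicities
  (\<open>dnprod_mult\<close>). Since arborification is multiplicative, \<open>\<rho>\<^sup><(\<alpha>\<degree>(w))\<close> satisfies the product
  rule of \<open>\<rho>(w)\<close> (\<open>coarb_mult\<close>).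

  It remains to compare the two operators on generators of the polynomial algebra. On a
  variable \<open>x\<^sub>i\<close> only single trees contribute, and as \<open>\<alpha>\<close> turns grafting a root \<open>\<eta>\<close> into
  prefixing the letter \<open>\<eta>\<close>, the value for \<open>\<eta> w\<close> on \<open>x\<^sub>i\<close> is the value for \<open>w\<close> on the
  polynomial \<open>E \<eta> x\<^sub>i\<close> (\<open>coarb_Cons_X\<close>), as for \<open>\<rho>\<close>. An induction on the degree of \<open>w\<close>,
  over all polynomials at once, finishes the proof (\<open>coarb_eq_fold\<close>).

  The product rule for the operators \<open>D_op a \<eta>\<close> is again an instance of \<open>dnprod_mult\<close>: grouping
  the decompositions of \<open>\<eta>\<close> by their underlying multisets turns \<open>1 / s!\<close> into
  \<open>1 / (d\<^sub>1! \<dots> d\<^sub>k!)\<close> (\<open>D_op_dnprod\<close>).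
\<close>

section \<open>Derivations of the polynomial algebra\<close>

lemma smul_sum_left: "smul (sum g S) u = (\<Sum>k\<in>S. smul (g k) u)"
  by (rule poly_mapping_eqI) (simp add: lookup_sum sum_distrib_right)

lemma pd_one [simp]: "pd i 1 = 0"
proof -
  have "pd i (basis 0) = 0" by (simp add: pd_basis)
  then show ?thesis by (simp add: basis_def)
qed

text \<open>The truncated subtraction of exponents is harmless because the coefficient \<open>m $ i\<close>
  vanishes whenever truncation occurs.\<close>

lemma pd_mult_basis:
  fixes m n :: "nat ^ 'n::finite"
  shows "pd i (basis m * basis n) = pd i (basis m) * basis n + basis m * pd i (basis n)"
proof -
  have shift: "k + l - axis i 1 = (k - axis i 1) + l" if "k $ i \<noteq> 0" for k l :: "nat ^ 'n"
    using that by (auto simp: vec_eq_iff axis_def)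
  have shifted: "smul (of_nat (k $ i)) (basis (k + l - axis i 1)) =
      smul (of_nat (k $ i)) (basis ((k - axis i 1) + l))" for k l :: "nat ^ 'n"
    by (cases "k $ i = 0") (simp, simp only: shift not_False_eq_True)
  show ?thesis
    using shifted[of m n] shifted[of n m]
    by (simp add: pd_basis basis_mult smul_add_left add.commute)
qed

lemma pd_mult: "pd i (p * p') = pd i p * p' + p * pd i p'"
proof (induction rule: span_induct[OF in_span_UNIV[of p]])
  case (2 c m p)
  have "pd i (basis m * p') = pd i (basis m) * p' + basis m * pd i p'"
    by (induction rule: span_induct[OF in_span_UNIV[of p']])
      (simp_all add: distrib_left pd_mult_basis)
  then show ?case using 2 by (simp add: distrib_right)
qed simp

lemma cpoly_induct [case_names one X mult add smul]:
  fixes p :: "'n::finite cpoly"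
  assumes one: "P 1" and X: "\<And>i. P (X i)"
    and mult: "\<And>p p'. P p \<Longrightarrow> P p' \<Longrightarrow> P (p * p')"
    and add: "\<And>p p'. P p \<Longrightarrow> P p' \<Longrightarrow> P (p + p')"
    and smul: "\<And>c p. P p \<Longrightarrow> P (smul c p)"
  shows "P p"
proof -
  have monomial: "P (basis m)" for m :: "nat ^ 'n"
  proof (induction "\<Sum>j\<in>UNIV. m $ j" arbitrary: m rule: less_induct)
    case less
    show ?case
    proof (cases "m = 0")
      case True
      then show ?thesis using one by (simp add: basis_def)
    next
      case False
      then obtain i where i: "m $ i \<noteq> 0" by (auto simp: vec_eq_iff)
      then have m: "axis i 1 + (m - axis i 1) = m" by (auto simp: vec_eq_iff axis_def)
      have "(\<Sum>j\<in>UNIV. (m - axis i 1) $ j) < (\<Sum>j\<in>UNIV. m $ j)"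
        using i by (intro sum_strict_mono_ex1) (auto simp: axis_def intro!: exI[of _ i])
      then have "P (X i * basis (m - axis i 1))" using less by (intro mult X)
      then show ?thesis unfolding X_def basis_mult m .
    qed
  qed
  show ?thesis
  proof (induction rule: span_induct[OF in_span_UNIV[of p]])
    case 1
    show ?case using smul[OF one, of 0] by simp
  qed (auto intro: add smul monomial)
qed

section \<open>Divided powers of vector fields\<close>

text \<open>The normally ordered product of the vector fields \<open>\<Sum>\<^sub>i c b i \<partial>\<^sub>i\<close>, \<open>b \<in># F\<close>: all
  coefficients stand to the left of all derivatives, so the factors commute and a multiset can
  index them. Both \<open>rho_lt_forest\<close> and \<open>D_op\<close> are expressed through it.\<close>

definition nprod :: "('b \<Rightarrow> 'n \<Rightarrow> 'n cpoly) \<Rightarrow> 'b multiset \<Rightarrow> 'n::finite oper"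
  where "nprod c = fold_mset (\<lambda>b L u. \<Sum>i\<in>UNIV. c b i * L (pd i u)) id"

definition dnprod :: "('b \<Rightarrow> 'n \<Rightarrow> 'n cpoly) \<Rightarrow> 'b multiset \<Rightarrow> 'n::finite oper"
  where "dnprod c F u = smul (1 / (\<Prod>b\<in>set_mset F. fact (count F b))) (nprod c F u)"

lemma nprod_empty [simp]: "nprod c {#} u = u"
  by (simp add: nprod_def)

lemma nprod_add_mset:
  fixes c :: "'b \<Rightarrow> 'n \<Rightarrow> 'n::finite cpoly"
  shows "nprod c (add_mset b F) u = (\<Sum>i\<in>UNIV. c b i * nprod c F (pd i u))"
proof -
  have swap: "(\<Sum>i\<in>UNIV. c b i * (\<Sum>j\<in>UNIV. c b' j * L (pd j (pd i u)))) =
      (\<Sum>i\<in>UNIV. c b' i * (\<Sum>j\<in>UNIV. c b j * L (pd j (pd i u))))" for b b' and L :: "'n oper" and u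
    unfolding sum_distrib_left
    by (subst sum.swap) (simp add: pd_commute mult.left_commute)
  interpret comp_fun_commute "\<lambda>b L u. \<Sum>i\<in>UNIV. c b i * L (pd i u)"
    by unfold_locales (simp add: fun_eq_iff swap)
  show ?thesis by (simp add: nprod_def)
qed

lemma nprod_linear [simp]:
  "nprod c F 0 = 0" "nprod c F (u + v) = nprod c F u + nprod c F v"
  "nprod c F (smul d u) = smul d (nprod c F u)"
  by (induction F arbitrary: u v)
    (simp_all add: nprod_add_mset smul_sum sum.distrib distrib_left)

text \<open>The fold over the multiset produces the sum over index lists in which \<open>rho_lt_forest\<close> and
  \<open>D_op\<close> are written; the derivatives appear in reversed order, hence the appeal to
  \<open>pds_mset\<close>.\<close>

lemma nprod_mset:
  fixes c :: "'b \<Rightarrow> 'n \<Rightarrow> 'n::finite cpoly"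
  shows "nprod c (mset Ts) u =
    (\<Sum>is | length is = length Ts. (\<Prod>k<length Ts. c (Ts ! k) (is ! k)) * pds is u)"
proof (induction Ts arbitrary: u)
  case Nil
  then show ?case by (simp add: pds_def)
next
  case (Cons T Ts)
  have index: "{is :: 'n list. length is = length (T # Ts)} =
      (\<lambda>(i, is). i # is) ` (UNIV \<times> {is. length is = length Ts})"
    by (auto simp: length_Suc_conv image_iff)
  have pds_shift: "pds (i # is) u = pds is (pd i u)" for i "is"
  proof -
    have "pds (i # is) = pds (is @ [i])" by (rule pds_mset) simp
    then show ?thesis by (simp add: pds_def)
  qed
  have "(\<Sum>is | length is = length (T # Ts).
        (\<Prod>k<length (T # Ts). c ((T # Ts) ! k) (is ! k)) * pds is u) =
      (\<Sum>(i, is)\<in>UNIV \<times> {is. length is = length Ts}.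
        (c T i * (\<Prod>k<length Ts. c (Ts ! k) (is ! k))) * pds is (pd i u))"
    unfolding index
    by (subst sum.reindex)
      (auto simp: inj_on_def prod.lessThan_Suc_shift pds_shift simp del: prod.lessThan_Suc intro!: sum.cong)
  also have "\<dots> = (\<Sum>i\<in>UNIV. c T i * nprod c (mset Ts) (pd i u))"
    by (simp add: sum.cartesian_product[symmetric] Cons.IH sum_distrib_left mult.assoc)
  finally show ?case by (simp add: nprod_add_mset)
qed

lemma dnprod_empty [simp]: "dnprod c {#} u = u"
  by (simp add: dnprod_def)

lemma dnprod_linear [simp]:
  "dnprod c F 0 = 0" "dnprod c F (u + v) = dnprod c F u + dnprod c F v"
  "dnprod c F (smul d u) = smul d (dnprod c F u)"
  by (simp_all add: dnprod_def mult.commute)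

lemma dnprod_one: "F \<noteq> {#} \<Longrightarrow> dnprod c F 1 = 0"
  by (cases F) (simp_all add: dnprod_def nprod_add_mset)

lemma dnprod_single: "dnprod c {#b#} u = (\<Sum>i\<in>UNIV. c b i * pd i u)"
  by (simp add: dnprod_def nprod_add_mset)

lemma dnprod_X: "dnprod c {#b#} (X i) = c b i"
  by (simp add: dnprod_single pd_X if_distrib cong: if_cong)

lemma dnprod_X_0: "size F > 1 \<Longrightarrow> dnprod c F (X i) = 0"
proof -
  assume "size F > 1"
  then obtain b G where F: "F = add_mset b G"
    by (cases F) auto
  then have "G \<noteq> {#}" using \<open>size F > 1\<close> by auto
  then obtain b' G' where "G = add_mset b' G'" by (cases G) auto
  moreover have "pd j (pd k (X i)) = 0" for j k by (simp add: pd_X)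
  ultimately show ?thesis by (simp add: F dnprod_def nprod_add_mset)
qed

text \<open>The analogue of \<open>(k + 1) x\<^sup>k\<^sup>+\<^sup>1 / (k + 1)! = x \<cdot> x\<^sup>k / k!\<close>. It lets inductions on
  multisets avoid binomial coefficients.\<close>

lemma dnprod_add_mset:
  "smul (of_nat (count F b + 1)) (dnprod c (add_mset b F) u) =
    (\<Sum>i\<in>UNIV. c b i * dnprod c F (pd i u))"
proof -
  let ?d = "\<lambda>F. \<Prod>b\<in>set_mset F. fact (count F b) :: complex"
  have "?d (add_mset b F) =
      (\<Prod>y\<in>set_mset (add_mset b F). (if y = b then of_nat (count F b + 1) else 1) * fact (count F y))"
    by (intro prod.cong) simp_all
  also have "\<dots> = of_nat (count F b + 1) * (\<Prod>y\<in>set_mset (add_mset b F). fact (count F y))"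
    by (simp add: prod.distrib)
  also have "(\<Prod>y\<in>set_mset (add_mset b F). fact (count F y)) = ?d F"
    by (intro prod.mono_neutral_right) (auto simp: not_in_iff)
  finally have d: "?d (add_mset b F) = of_nat (count F b + 1) * ?d F" .
  have "of_nat (count F b + 1) \<noteq> (0 :: complex)" by (metis Suc_eq_plus1 of_nat_neq_0)
  then show ?thesis
    by (simp only: dnprod_def d nprod_add_mset smul_simps smul_sum smul_mult) simp
qed

lemma finite_mset_pairs [simp]: "finite {(A, B). A + B = (F :: 'b multiset)}"
proof (induction F)
  case (add b F)
  have "{(A, B). A + B = add_mset b F} \<subseteq>
      (\<lambda>(A, B). (add_mset b A, B)) ` {(A, B). A + B = F} \<union>
      (\<lambda>(A, B). (A, add_mset b B)) ` {(A, B). A + B = F}"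
  proof (clarify)
    fix A B assume *: "A + B = add_mset b F"
      and "(A, B) \<notin> (\<lambda>(A, B). (A, add_mset b B)) ` {(A, B). A + B = F}"
    show "(A, B) \<in> (\<lambda>(A, B). (add_mset b A, B)) ` {(A, B). A + B = F}"
    proof (cases "b \<in># A")
      case True
      then obtain A' where "A = add_mset b A'" by (metis insert_DiffM)
      then show ?thesis using * by auto
    next
      case False
      then have "b \<in># B" using * by (metis union_iff union_single_eq_member)
      then obtain B' where "B = add_mset b B'" by (metis insert_DiffM)
      then have "(A, B) \<in> (\<lambda>(A, B). (A, add_mset b B)) ` {(A, B). A + B = F}"
        using * by auto
      then show ?thesis using \<open>(A, B) \<notin> _\<close> by contradiction
    qed
  qed
  then show ?case by (rule finite_subset) (intro finite_UnI finite_imageI add.IH)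
qed simp

text \<open>Adding \<open>b\<close> to the first component misses only the pairs whose first component does not
  contain \<open>b\<close>, and these carry the weight \<open>0\<close> on the right.\<close>

lemma sum_mset_pairs_count:
  fixes h :: "'b multiset \<Rightarrow> 'b multiset \<Rightarrow> 'a \<Rightarrow>\<^sub>0 complex"
  shows "(\<Sum>(A, B) | A + B = F. smul (of_nat (count A b + 1)) (h (add_mset b A) B)) =
    (\<Sum>(A, B) | A + B = add_mset b F. smul (of_nat (count A b)) (h A B))"
proof -
  let ?f = "\<lambda>(A, B). (add_mset b A, B)"
  have sub: "?f ` {(A, B). A + B = F} \<subseteq> {(A, B). A + B = add_mset b F}" by auto
  have zero: "smul (of_nat (count A b)) (h A B) = 0"
    if "(A, B) \<notin> ?f ` {(A, B). A + B = F}" "A + B = add_mset b F" for A B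
  proof -
    have "b \<notin># A"
    proof
      assume "b \<in># A"
      then obtain A' where "A = add_mset b A'" by (metis insert_DiffM)
      then show False using that by auto
    qed
    then show ?thesis by (simp add: not_in_iff)
  qed
  have "(\<Sum>(A, B) | A + B = add_mset b F. smul (of_nat (count A b)) (h A B)) =
      (\<Sum>(A, B)\<in>?f ` {(A, B). A + B = F}. smul (of_nat (count A b)) (h A B))"
    using sub zero by (intro sum.mono_neutral_right) auto
  also have "\<dots> = (\<Sum>(A, B) | A + B = F. smul (of_nat (count A b + 1)) (h (add_mset b A) B))"
    by (subst sum.reindex) (auto simp: inj_on_def intro!: sum.cong)
  finally show ?thesis by simp
qed

lemma sum_mset_pairs_swap:
  "(\<Sum>(A, B) | A + B = F. h A B) = (\<Sum>(A, B) | A + B = (F :: 'b multiset). h B A)"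
  by (rule sum.reindex_bij_witness[where i = prod.swap and j = prod.swap])
    (auto simp: add.commute)

text \<open>Multiplying the claim for \<open>add_mset b F\<close> by the multiplicity \<open>k\<close> of \<open>b\<close> removes one factor
  \<open>b\<close>, after which the ordinary Leibniz rule applies. This distributes \<open>b\<close> to \<open>A\<close> with weight
  \<open>count A b\<close> and to \<open>B\<close> with weight \<open>count B b\<close>, and the two weights add up to \<open>k\<close>.\<close>

lemma dnprod_mult:
  fixes c :: "'b \<Rightarrow> 'n \<Rightarrow> 'n::finite cpoly"
  shows "dnprod c F (p * p') = (\<Sum>(A, B) | A + B = F. dnprod c A p * dnprod c B p')"
proof (induction F arbitrary: p p')
  case empty
  have "{(A, B). A + B = ({#} :: 'b multiset)} = {({#}, {#})}" by auto
  then show ?case by simp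
next
  case (add b F)
  let ?h = "\<lambda>A B. dnprod c A p * dnprod c B p'"
  let ?k = "of_nat (count F b + 1) :: complex"
  have "smul ?k (dnprod c (add_mset b F) (p * p')) =
      (\<Sum>i\<in>UNIV. c b i * dnprod c F (pd i p * p')) + (\<Sum>i\<in>UNIV. c b i * dnprod c F (p * pd i p'))"
    by (simp only: dnprod_add_mset pd_mult dnprod_linear distrib_left sum.distrib)
  also have "(\<Sum>i\<in>UNIV. c b i * dnprod c F (pd i p * p')) =
      (\<Sum>(A, B) | A + B = F. smul (of_nat (count A b + 1)) (?h (add_mset b A) B))"
    unfolding add.IH sum_distrib_left
    by (subst sum.swap)
      (simp only: smul_mult(1)[symmetric] dnprod_add_mset sum_distrib_right split_def mult.assoc)
  also have "\<dots> = (\<Sum>(A, B) | A + B = add_mset b F. smul (of_nat (count A b)) (?h A B))"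
    by (rule sum_mset_pairs_count)
  also have "(\<Sum>i\<in>UNIV. c b i * dnprod c F (p * pd i p')) =
      (\<Sum>(A, B) | A + B = F. smul (of_nat (count B b + 1)) (?h A (add_mset b B)))"
    unfolding add.IH sum_distrib_left
    by (subst sum.swap)
      (simp only: smul_mult(2)[symmetric] dnprod_add_mset sum_distrib_left split_def mult.left_commute)
  also have "\<dots> = (\<Sum>(A, B) | A + B = F. smul (of_nat (count A b + 1)) (?h B (add_mset b A)))"
    by (rule sum_mset_pairs_swap)
  also have "\<dots> = (\<Sum>(A, B) | A + B = add_mset b F. smul (of_nat (count A b)) (?h B A))"
    by (rule sum_mset_pairs_count)
  also have "\<dots> = (\<Sum>(A, B) | A + B = add_mset b F. smul (of_nat (count B b)) (?h A B))"
    by (rule sum_mset_pairs_swap)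
  also have "(\<Sum>(A, B) | A + B = add_mset b F. smul (of_nat (count A b)) (?h A B)) +
      (\<Sum>(A, B) | A + B = add_mset b F. smul (of_nat (count B b)) (?h A B)) =
      (\<Sum>(A, B) | A + B = add_mset b F. smul (of_nat (count A b + count B b)) (?h A B))"
    by (simp add: sum.distrib[symmetric] smul_add_left split_def)
  also have "\<dots> = (\<Sum>(A, B) | A + B = add_mset b F. smul ?k (?h A B))"
  proof (intro sum.cong refl, clarify)
    fix A B assume "A + B = add_mset b F"
    then have "count A b + count B b = count F b + 1"
      by (metis count_union count_add_mset Suc_eq_plus1)
    then show "smul (of_nat (count A b + count B b)) (?h A B) = smul ?k (?h A B)" by simp
  qed
  also have "\<dots> = smul ?k (\<Sum>(A, B) | A + B = add_mset b F. ?h A B)"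
    by (simp add: smul_sum split_def)
  finally have eq: "smul ?k (dnprod c (add_mset b F) (p * p')) =
      smul ?k (\<Sum>(A, B) | A + B = add_mset b F. ?h A B)" .
  have k: "?k \<noteq> 0" by (metis Suc_eq_plus1 of_nat_neq_0)
  have "smul (1 / ?k) (smul ?k u) = u" for u :: "'n cpoly" using k by simp
  then show ?case using eq by metis
qed

lemma sum_mset_pairs_sum:
  fixes K :: "'b multiset set"
  assumes "finite K"
  shows "finite {(A, B). A + B \<in> K}"
    and "(\<Sum>M\<in>K. \<Sum>(A, B) | A + B = M. h A B) = (\<Sum>(A, B) | A + B \<in> K. h A B)"
proof -
  have U: "{(A, B). A + B \<in> K} = (\<Union>M\<in>K. {(A, B). A + B = M})" by auto
  show "finite {(A, B). A + B \<in> K}"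
    unfolding U by (rule finite_UN_I[OF assms finite_mset_pairs])
  show "(\<Sum>M\<in>K. \<Sum>(A, B) | A + B = M. h A B) = (\<Sum>(A, B) | A + B \<in> K. h A B)"
    unfolding U by (rule sum.UNION_disjoint[symmetric]) (use assms in auto)
qed

section \<open>Letters\<close>

text \<open>An element of \<open>Hbar\<close> is a sum of at most \<open>gr \<eta>\<close> elements of \<open>H\<close>, whose entries are all at
  least \<open>-1\<close>. This is what makes the sums over \<open>\<alpha> + \<beta> = \<eta>\<close> finite.\<close>

lemma Hbar_bounds: "\<eta> \<in> Hbar \<Longrightarrow> 1 \<le> gr \<eta> \<and> (\<forall>j. - gr \<eta> \<le> \<eta> $ j)"
proof (induction rule: Hbar.induct)
  case (1 \<eta>)
  then obtain i where "\<eta> \<in> Hi i" by (auto simp: H_def)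
  then have "1 \<le> gr \<eta>" "(if j = i then -1 else 0) \<le> \<eta> $ j" for j by (simp_all add: Hi_iff)
  then show ?case by (smt (verit))
next
  case (2 \<eta> \<theta>)
  have "- gr (\<eta> + \<theta>) \<le> (\<eta> + \<theta>) $ j" for j
    using 2(3)[THEN conjunct2, rule_format, of j] 2(4)[THEN conjunct2, rule_format, of j] by simp
  then show ?case using 2 by simp
qed

lemma gr_Hbar: "\<eta> \<in> Hbar \<Longrightarrow> 1 \<le> gr \<eta>"
  using Hbar_bounds by blast

lemma gr_lists_Hbar: "w \<in> lists Hbar \<Longrightarrow> 0 \<le> gr (sum_list w)"
  by (induction w) (auto dest: gr_Hbar)

lemma finite_Hbar_le: "finite {\<eta> \<in> Hbar. gr (\<eta> :: int ^ 'n::finite) \<le> N}"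
proof -
  let ?b = "N + int CARD('n) * N"
  let ?V = "(vec_lambda :: ('n \<Rightarrow> int) \<Rightarrow> int ^ 'n) ` (UNIV \<rightarrow>\<^sub>E {-N..?b})"
  have "\<eta> \<in> ?V" if "\<eta> \<in> Hbar" "gr \<eta> \<le> N" for \<eta> :: "int ^ 'n"
  proof -
    have "- gr \<eta> \<le> \<eta> $ j" for j using Hbar_bounds[OF that(1)] by blast
    then have lo: "- N \<le> \<eta> $ j" for j using that(2) by (meson neg_le_iff_le order_trans)
    have hi: "\<eta> $ j \<le> ?b" for j
    proof -
      have nonneg: "0 \<le> \<eta> $ k + N" for k using lo[of k] by linarith
      have "\<eta> $ j + N \<le> (\<Sum>k\<in>UNIV. \<eta> $ k + N)"
        by (rule member_le_sum[where f = "\<lambda>k. \<eta> $ k + N"]) (auto simp: nonneg)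
      also have "\<dots> = gr \<eta> + int CARD('n) * N" by (simp add: gr_def sum.distrib)
      finally show ?thesis using that(2) gr_Hbar[OF that(1)] by linarith
    qed
    have "vec_nth \<eta> \<in> UNIV \<rightarrow>\<^sub>E {-N..?b}" using lo hi by auto
    then show ?thesis by (metis imageI vec_nth_inverse)
  qed
  moreover have "finite ?V" by (intro finite_imageI finite_PiE) auto
  ultimately show ?thesis by (auto intro: finite_subset)
qed

definition letter_splits :: "int ^ 'n::finite \<Rightarrow> ((int ^ 'n) \<times> (int ^ 'n)) set"
  where "letter_splits \<eta> = {(\<alpha>, \<beta>). \<alpha> \<in> Hbar \<and> \<beta> \<in> Hbar \<and> \<alpha> + \<beta> = \<eta>}"

lemma finite_letter_splits [simp]: "finite (letter_splits \<eta>)"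
proof (rule finite_subset)
  show "letter_splits \<eta> \<subseteq> {\<alpha> \<in> Hbar. gr \<alpha> \<le> gr \<eta>} \<times> {\<beta> \<in> Hbar. gr \<beta> \<le> gr \<eta>}"
  proof
    fix s assume "s \<in> letter_splits \<eta>"
    then obtain \<alpha> \<beta> where s: "s = (\<alpha>, \<beta>)" "\<alpha> \<in> Hbar" "\<beta> \<in> Hbar" "gr \<alpha> + gr \<beta> = gr \<eta>"
      by (auto simp: letter_splits_def)
    then show "s \<in> {\<alpha> \<in> Hbar. gr \<alpha> \<le> gr \<eta>} \<times> {\<beta> \<in> Hbar. gr \<beta> \<le> gr \<eta>}"
      using gr_Hbar[of \<alpha>] gr_Hbar[of \<beta>] by simp
  qed
qed (intro finite_cartesian_product finite_Hbar_le)

section \<open>Operators attached to the letters\<close>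

text \<open>What the two cases have in common: \<open>q = 0\<close> with \<open>B_op\<close>, and \<open>q = 1\<close> with \<open>D_op\<close>. The
  letters of words range over \<open>Hbar\<close> in both cases, while trees are decorated by \<open>H\<close>; condition
  \<open>E_X\<close> is the compatibility between the two alphabets.\<close>

locale letter_operators =
  fixes q :: complex and E :: "int ^ 'n::finite \<Rightarrow> 'n oper"
  assumes E_add: "E \<eta> (p + p') = E \<eta> p + E \<eta> p'"
    and E_smul: "E \<eta> (smul d p) = smul d (E \<eta> p)"
    and E_one: "E \<eta> 1 = 0"
    and E_X: "\<eta> \<notin> H \<Longrightarrow> E \<eta> (X i) = 0"
    and E_mult: "E \<eta> (p * p') = E \<eta> p * p' + p * E \<eta> p'
      + smul q (\<Sum>(\<alpha>, \<beta>)\<in>letter_splits \<eta>. E \<alpha> p * E \<beta> p')"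

text \<open>\<open>vf_coeff a \<eta> i\<close> is the coefficient of \<open>\<partial>\<^sub>i\<close> in the degree-\<open>\<eta>\<close> part of the given formal
  vector field or diffeomorphism.\<close>

definition vf_coeff :: "('n \<Rightarrow> int ^ 'n \<Rightarrow> complex) \<Rightarrow> int ^ 'n \<Rightarrow> 'n \<Rightarrow> 'n::finite cpoly"
  where "vf_coeff a \<eta> i = smul (a i \<eta>) (xpow (\<eta> + axis i 1))"

lemma B_op_dnprod: "B_op a \<eta> = dnprod (vf_coeff a) {#\<eta>#}"
  by (simp add: fun_eq_iff B_op_def dnprod_single vf_coeff_def)

lemma letter_operators_B:
  assumes "\<And>i \<eta>. \<eta> \<notin> Hi i \<Longrightarrow> a i \<eta> = 0"
  shows "letter_operators 0 (B_op a)"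
proof
  show "B_op a \<eta> (X i) = 0" if "\<eta> \<notin> H" for \<eta> i
    using that assms by (simp add: B_op_dnprod dnprod_X vf_coeff_def H_def)
  show "B_op a \<eta> (p * p') = B_op a \<eta> p * p' + p * B_op a \<eta> p' +
      smul 0 (\<Sum>(\<alpha>, \<beta>)\<in>letter_splits \<eta>. B_op a \<alpha> p * B_op a \<beta> p')" for \<eta> p p'
    by (simp add: B_op_dnprod dnprod_single pd_mult algebra_simps sum.distrib
        sum_distrib_left)
qed (simp_all add: B_op_dnprod dnprod_one)

definition mset_decomps :: "int ^ 'n::finite \<Rightarrow> (int ^ 'n) multiset set"
  where "mset_decomps \<eta> = {M. M \<noteq> {#} \<and> set_mset M \<subseteq> H \<and> sum_mset M = \<eta>}"

lemma mset_decomps_eq: "mset_decomps \<eta> = mset ` decomps \<eta>"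
proof -
  have "mset \<eta>s \<in> mset_decomps \<eta> \<longleftrightarrow> \<eta>s \<in> decomps \<eta>" for \<eta>s
    by (auto simp: mset_decomps_def decomps_def sum_mset_sum_list)
  then show ?thesis by (auto simp: image_iff) (metis ex_mset)
qed

lemma finite_mset_decomps [simp]: "finite (mset_decomps \<eta>)"
  by (simp add: mset_decomps_eq finite_decomps)

lemma sum_mset_Hbar: "M \<noteq> {#} \<Longrightarrow> set_mset M \<subseteq> H \<Longrightarrow> sum_mset M \<in> Hbar"
proof (induction M)
  case (add \<eta> M)
  then show ?case by (cases "M = {#}") (auto intro: Hbar.intros)
qed simp

lemma xpow_mult:
  assumes "\<And>j. 0 \<le> m $ j" "\<And>j. 0 \<le> m' $ j"
  shows "xpow m * xpow m' = xpow (m + m')"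
proof -
  have "(\<chi> j. nat (m $ j)) + (\<chi> j. nat (m' $ j)) = (\<chi> j. nat ((m + m') $ j))"
    using assms by (simp add: vec_eq_iff nat_add_distrib)
  then show ?thesis by (simp only: xpow_def basis_mult)
qed

text \<open>The function \<open>xpow\<close> truncates negative exponents and is not multiplicative in general. Here
  it is: a factor with \<open>a i \<eta> \<noteq> 0\<close> has \<open>\<eta> \<in> Hi i\<close> and hence nonnegative exponents, and if one
  coefficient vanishes, so do both sides. The induction carries this nonnegativity along.\<close>

lemma prod_vf_coeff:
  assumes "\<And>i \<eta>. \<eta> \<notin> Hi i \<Longrightarrow> a i \<eta> = 0" and "length \<eta>s = length js"
  shows "(\<Prod>k<length \<eta>s. vf_coeff a (\<eta>s ! k) (js ! k)) =
    smul (\<Prod>k<length \<eta>s. a (js ! k) (\<eta>s ! k)) (xpow (sum_list \<eta>s + (\<Sum>i\<leftarrow>js. axis i 1)))"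
proof -
  let ?s = "\<lambda>\<eta>s js. sum_list \<eta>s + (\<Sum>i\<leftarrow>js. axis i 1)"
  have "(\<Prod>k<length \<eta>s. vf_coeff a (\<eta>s ! k) (js ! k)) =
      smul (\<Prod>k<length \<eta>s. a (js ! k) (\<eta>s ! k)) (xpow (?s \<eta>s js)) \<and>
    ((\<Prod>k<length \<eta>s. a (js ! k) (\<eta>s ! k)) \<noteq> 0 \<longrightarrow> (\<forall>j. 0 \<le> ?s \<eta>s js $ j))"
    using assms(2)
  proof (induction \<eta>s js rule: list_induct2)
    case Nil
    have "(\<chi> j. nat (0 $ j)) = (0 :: nat ^ 'a)" by (simp add: vec_eq_iff)
    then show ?case by (simp add: xpow_def basis_def)
  next
    case (Cons \<eta> \<eta>s i js)
    let ?P = "\<Prod>k<length \<eta>s. a (js ! k) (\<eta>s ! k)"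
    have s: "?s (\<eta> # \<eta>s) (i # js) = (\<eta> + axis i 1) + ?s \<eta>s js" by simp
    have P: "(\<Prod>k<length (\<eta> # \<eta>s). a ((i # js) ! k) ((\<eta> # \<eta>s) ! k)) = a i \<eta> * ?P"
      and V: "(\<Prod>k<length (\<eta> # \<eta>s). vf_coeff a ((\<eta> # \<eta>s) ! k) ((i # js) ! k)) =
        vf_coeff a \<eta> i * (\<Prod>k<length \<eta>s. vf_coeff a (\<eta>s ! k) (js ! k))"
      by (simp_all add: prod.lessThan_Suc_shift del: prod.lessThan_Suc)
    have M: "vf_coeff a \<eta> i * (\<Prod>k<length \<eta>s. vf_coeff a (\<eta>s ! k) (js ! k)) =
        smul (a i \<eta> * ?P) (xpow (\<eta> + axis i 1) * xpow (?s \<eta>s js))"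
      unfolding Cons.IH[THEN conjunct1] by (simp add: vf_coeff_def mult.commute)
    show ?case
    proof (cases "a i \<eta> * ?P = 0")
      case True
      then show ?thesis unfolding P V M True by simp
    next
      case False
      then have "\<eta> \<in> Hi i" using assms(1) by fastforce
      then have ge: "(if j = i then - 1 else 0) \<le> \<eta> $ j" for j by (simp add: Hi_iff)
      have 1: "0 \<le> (\<eta> + axis i 1) $ j" for j
        using ge[of j] by (cases "j = i") (simp_all add: axis_def)
      have 2: "0 \<le> ?s \<eta>s js $ j" for j using False Cons.IH by simp
      have "xpow (\<eta> + axis i 1) * xpow (?s \<eta>s js) = xpow (?s (\<eta> # \<eta>s) (i # js))"
        unfolding s by (rule xpow_mult[OF 1 2])
      moreover have "\<forall>j. 0 \<le> ?s (\<eta> # \<eta>s) (i # js) $ j"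
        unfolding s using 1 2 by (metis add_nonneg_nonneg vector_add_component)
      ultimately show ?thesis unfolding P V M by simp
    qed
  qed
  then show ?thesis by blast
qed

text \<open>The lists in \<open>decomps \<eta>\<close> with the same underlying multiset \<open>M\<close> contribute equally, and
  their number is the multinomial coefficient \<open>(size M)! / \<Prod>\<^sub>b (count M b)!\<close>.\<close>

lemma D_op_dnprod:
  assumes "\<And>i \<eta>. \<eta> \<notin> Hi i \<Longrightarrow> a i \<eta> = 0"
  shows "D_op a \<eta> u = (\<Sum>M\<in>mset_decomps \<eta>. dnprod (vf_coeff a) M u)"
proof -
  let ?n = "\<lambda>M. nprod (vf_coeff a) M u"
  have "D_op a \<eta> u = (\<Sum>\<eta>s\<in>decomps \<eta>. smul (1 / fact (length \<eta>s)) (?n (mset \<eta>s)))"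
    unfolding D_op_def nprod_mset smul_sum
  proof (intro sum.cong refl)
    fix \<eta>s and "is" :: "'a list"
    assume "\<eta>s \<in> decomps \<eta>" "is \<in> {is. length is = length \<eta>s}"
    then have "sum_list \<eta>s = \<eta>" "length \<eta>s = length is" by (auto simp: decomps_def)
    then show "smul (1 / fact (length \<eta>s) * (\<Prod>k<length \<eta>s. a (is ! k) (\<eta>s ! k)))
        (xpow (\<eta> + (\<Sum>i\<leftarrow>is. axis i 1)) * pds is u) =
      smul (1 / fact (length \<eta>s)) ((\<Prod>k<length \<eta>s. vf_coeff a (\<eta>s ! k) (is ! k)) * pds is u)"
      using prod_vf_coeff[of a \<eta>s "is"] assms by simp
  qed
  also have "\<dots> = (\<Sum>M\<in>mset_decomps \<eta>. \<Sum>\<eta>s | \<eta>s \<in> decomps \<eta> \<and> mset \<eta>s = M.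
      smul (1 / fact (length \<eta>s)) (?n (mset \<eta>s)))"
    unfolding mset_decomps_eq by (rule sum.image_gen[OF finite_decomps])
  also have "\<dots> = (\<Sum>M\<in>mset_decomps \<eta>. dnprod (vf_coeff a) M u)"
  proof (intro sum.cong refl)
    fix M assume M: "M \<in> mset_decomps \<eta>"
    have S: "{\<eta>s. \<eta>s \<in> decomps \<eta> \<and> mset \<eta>s = M} = permutations_of_multiset M"
    proof -
      have "\<eta>s \<in> decomps \<eta>" if "mset \<eta>s = M" for \<eta>s
        using M that by (auto simp: mset_decomps_def decomps_def sum_mset_sum_list)
      then show ?thesis by (auto simp: permutations_of_multiset_def)
    qed
    let ?d = "\<Prod>b\<in>set_mset M. fact (count M b) :: nat"
    have d: "of_nat (card (permutations_of_multiset M)) * of_nat ?d = (fact (size M) :: complex)"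
      using card_permutations_of_multiset_aux[of M] by (metis of_nat_fact of_nat_mult)
    have "?d \<noteq> 0" by simp
    then have "of_nat ?d \<noteq> (0 :: complex)" by (simp only: of_nat_eq_0_iff) simp
    then have c: "of_nat (card (permutations_of_multiset M)) * (1 / fact (size M)) =
        (1 / of_nat ?d :: complex)"
      unfolding d[symmetric] by (simp add: field_simps)
    have "(\<Sum>\<eta>s\<in>permutations_of_multiset M. smul (1 / fact (length \<eta>s)) (?n (mset \<eta>s))) =
        (\<Sum>\<eta>s\<in>permutations_of_multiset M. smul (1 / fact (size M)) (?n M))"
      by (intro sum.cong) (auto simp: permutations_of_multiset_def)
    also have "\<dots> = smul (\<Sum>\<eta>s\<in>permutations_of_multiset M. 1 / fact (size M)) (?n M)"
      by (simp only: smul_sum_left)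
    also have "\<dots> = smul (1 / of_nat ?d) (?n M)" by (simp only: sum_constant c)
    finally show "(\<Sum>\<eta>s | \<eta>s \<in> decomps \<eta> \<and> mset \<eta>s = M.
        smul (1 / fact (length \<eta>s)) (?n (mset \<eta>s))) = dnprod (vf_coeff a) M u"
      unfolding S by (simp add: dnprod_def)
  qed
  finally show ?thesis .
qed

text \<open>In the Leibniz rule for \<open>D_op a \<eta>\<close> these three parts give, in this order, the terms
  \<open>p \<cdot> D_op a \<eta> p'\<close>, \<open>D_op a \<eta> p \<cdot> p'\<close> and the sum over \<open>\<alpha> + \<beta> = \<eta>\<close>.\<close>

lemma mset_decomps_pairs:
  "{(A, B). A + B \<in> mset_decomps \<eta>} =
    {{#}} \<times> mset_decomps \<eta> \<union> mset_decomps \<eta> \<times> {{#}} \<union>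
    (\<Union>(\<alpha>, \<beta>)\<in>letter_splits \<eta>. mset_decomps \<alpha> \<times> mset_decomps \<beta>)" (is "?L = ?R")
proof
  show "?L \<subseteq> ?R"
  proof
    fix s assume "s \<in> ?L"
    then obtain A B where s: "s = (A, B)" "A + B \<in> mset_decomps \<eta>" by blast
    show "s \<in> ?R"
    proof (cases "A = {#} \<or> B = {#}")
      case True
      then show ?thesis using s by auto
    next
      case False
      then have "A \<in> mset_decomps (sum_mset A)" "B \<in> mset_decomps (sum_mset B)"
        "(sum_mset A, sum_mset B) \<in> letter_splits \<eta>"
        using s(2) by (auto simp: mset_decomps_def letter_splits_def intro!: sum_mset_Hbar)
      then show ?thesis unfolding s(1) by blast
    qed
  qed
  show "?R \<subseteq> ?L" by (auto simp: mset_decomps_def letter_splits_def)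
qed

text \<open>The product rule is \<open>dnprod_mult\<close> summed over \<open>mset_decomps \<eta>\<close>, with the pairs \<open>(A, B)\<close>
  sorted by \<open>mset_decomps_pairs\<close>. On a variable only multisets with one element survive, and such a multiset \<open>{#\<eta>#}\<close> is
  available only for \<open>\<eta> \<in> H\<close>.\<close>

lemma letter_operators_D:
  assumes a: "\<And>i \<eta>. \<eta> \<notin> Hi i \<Longrightarrow> a i \<eta> = 0"
  shows "letter_operators 1 (D_op a)"
proof
  have D: "D_op a \<eta> u = (\<Sum>M\<in>mset_decomps \<eta>. dnprod (vf_coeff a) M u)" for \<eta> u
    using a by (rule D_op_dnprod)
  fix \<eta> i p p'
  show "D_op a \<eta> (p + p') = D_op a \<eta> p + D_op a \<eta> p'"
    and "D_op a \<eta> (smul d p) = smul d (D_op a \<eta> p)" for d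
    by (simp_all add: D sum.distrib smul_sum)
  show "D_op a \<eta> 1 = 0"
    by (auto simp: D mset_decomps_def dnprod_one intro!: sum.neutral)
  show "D_op a \<eta> (X i) = 0" if "\<eta> \<notin> H"
    unfolding D
  proof (intro sum.neutral ballI)
    fix M assume M: "M \<in> mset_decomps \<eta>"
    have "size M \<noteq> 0" using M by (simp add: mset_decomps_def)
    moreover have "size M \<noteq> 1"
    proof
      assume "size M = 1"
      then obtain \<theta> where "M = {#\<theta>#}" by (metis size_1_singleton_mset)
      then show False using M \<open>\<eta> \<notin> H\<close> by (auto simp: mset_decomps_def)
    qed
    ultimately show "dnprod (vf_coeff a) M (X i) = 0" by (intro dnprod_X_0) linarith
  qed
  let ?h = "\<lambda>A B. dnprod (vf_coeff a) A p * dnprod (vf_coeff a) B p'"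
  let ?N = "{{#} :: (int ^ 'a) multiset}"
  let ?U = "\<Union>(\<alpha>, \<beta>)\<in>letter_splits \<eta>. mset_decomps \<alpha> \<times> mset_decomps \<beta>"
  have fin: "finite ?U" by auto
  have ne: "{#} \<notin> mset_decomps \<theta>" for \<theta> :: "int ^ 'a" by (simp add: mset_decomps_def)
  have "D_op a \<eta> (p * p') = (\<Sum>(A, B) | A + B \<in> mset_decomps \<eta>. ?h A B)"
    by (simp only: D dnprod_mult sum_mset_pairs_sum(2)[OF finite_mset_decomps])
  also have "\<dots> = (\<Sum>(A, B)\<in>?N \<times> mset_decomps \<eta>. ?h A B)
      + (\<Sum>(A, B)\<in>mset_decomps \<eta> \<times> ?N. ?h A B) + (\<Sum>(A, B)\<in>?U. ?h A B)"
    unfolding mset_decomps_pairs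
    by (subst sum.union_disjoint; (subst sum.union_disjoint)?)
      (use fin in \<open>auto simp: ne\<close>)
  also have "(\<Sum>(A, B)\<in>?N \<times> mset_decomps \<eta>. ?h A B) = p * D_op a \<eta> p'"
    by (simp add: sum.cartesian_product[symmetric] D sum_distrib_left)
  also have "(\<Sum>(A, B)\<in>mset_decomps \<eta> \<times> ?N. ?h A B) = D_op a \<eta> p * p'"
    by (simp add: sum.cartesian_product[symmetric] D sum_distrib_right)
  also have "(\<Sum>(A, B)\<in>?U. ?h A B) =
      (\<Sum>(\<alpha>, \<beta>)\<in>letter_splits \<eta>. D_op a \<alpha> p * D_op a \<beta> p')"
  proof -
    have "(\<Sum>(A, B)\<in>?U. ?h A B) =
        (\<Sum>s\<in>letter_splits \<eta>. \<Sum>(A, B)\<in>mset_decomps (fst s) \<times> mset_decomps (snd s). ?h A B)"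
      unfolding split_def
      by (rule sum.UNION_disjoint)
        (auto, auto simp: mset_decomps_def)
    also have "\<dots> = (\<Sum>(\<alpha>, \<beta>)\<in>letter_splits \<eta>. D_op a \<alpha> p * D_op a \<beta> p')"
      by (simp only: split_def D sum_product sum.cartesian_product)
    finally show ?thesis .
  qed
  finally show "D_op a \<eta> (p * p') = D_op a \<eta> p * p' + p * D_op a \<eta> p' +
      smul 1 (\<Sum>(\<alpha>, \<beta>)\<in>letter_splits \<eta>. D_op a \<alpha> p * D_op a \<beta> p')"
    by (simp add: add.commute)
qed

section \<open>The convolution dual to the quasishuffle product\<close>

text \<open>A polynomial-valued function on words is a formal series of words; \<open>qconv\<close> is the
  quasishuffle product of such series, with values multiplied in the polynomial algebra. The
  recursion reads off the coefficient of \<open>\<eta> # w\<close> in the recursion of \<open>qsh\<close>: the first letter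
  \<open>\<eta>\<close> comes from the left factor, from the right factor, or is the sum of one letter from
  each. Series of infinite support cause no problem, as each coefficient is a finite sum.\<close>

fun qconv :: "complex \<Rightarrow> ((int ^ 'n) list \<Rightarrow> 'n cpoly) \<Rightarrow> ((int ^ 'n) list \<Rightarrow> 'n cpoly) \<Rightarrow>
    (int ^ 'n::finite) list \<Rightarrow> 'n cpoly"
  where
    "qconv q f g [] = f [] * g []"
  | "qconv q f g (\<eta> # w) = qconv q (\<lambda>u. f (\<eta> # u)) g w + qconv q f (\<lambda>u. g (\<eta> # u)) w
      + smul q (\<Sum>(\<alpha>, \<beta>)\<in>letter_splits \<eta>. qconv q (\<lambda>u. f (\<alpha> # u)) (\<lambda>u. g (\<beta> # u)) w)"

text \<open>The recursion only looks at words over \<open>Hbar\<close> whose degree does not exceed that of \<open>w\<close>,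
  because all letters have positive degree.\<close>

lemma qconv_cong:
  assumes "w \<in> lists Hbar"
    and "\<And>u. u \<in> lists Hbar \<Longrightarrow> gr (sum_list u) \<le> gr (sum_list w) \<Longrightarrow> f u = f' u"
    and "\<And>u. u \<in> lists Hbar \<Longrightarrow> gr (sum_list u) \<le> gr (sum_list w) \<Longrightarrow> g u = g' u"
  shows "qconv q f g w = qconv q f' g' w"
  using assms
proof (induction w arbitrary: f f' g g' rule: list.induct)
  case (Cons \<eta> w)
  have \<eta>: "\<eta> \<in> Hbar" "1 \<le> gr \<eta>" and w: "w \<in> lists Hbar"
    using Cons.prems(1) by (auto intro: gr_Hbar)
  note f = Cons.prems(2) and g = Cons.prems(3)
  have "qconv q (\<lambda>u. f (\<eta> # u)) g w = qconv q (\<lambda>u. f' (\<eta> # u)) g' w"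
    by (intro Cons.IH w f g) (use \<eta> in auto)
  moreover have "qconv q f (\<lambda>u. g (\<eta> # u)) w = qconv q f' (\<lambda>u. g' (\<eta> # u)) w"
    by (intro Cons.IH w f g) (use \<eta> in auto)
  moreover have "qconv q (\<lambda>u. f (\<alpha> # u)) (\<lambda>u. g (\<beta> # u)) w =
      qconv q (\<lambda>u. f' (\<alpha> # u)) (\<lambda>u. g' (\<beta> # u)) w" if "(\<alpha>, \<beta>) \<in> letter_splits \<eta>" for \<alpha> \<beta>
  proof -
    have "\<alpha> \<in> Hbar" "\<beta> \<in> Hbar" "1 \<le> gr \<alpha>" "1 \<le> gr \<beta>" "gr \<alpha> + gr \<beta> = gr \<eta>"
      using that gr_Hbar by (auto simp: letter_splits_def)
    then show ?thesis by (intro Cons.IH w f g) auto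
  qed
  ultimately show ?case by (auto intro!: sum.cong arg_cong[where f = "smul q"])
qed simp

lemma qconv_zero [simp]: "qconv q (\<lambda>u. 0) g w = 0" "qconv q f (\<lambda>u. 0) w = 0"
  by (induction w arbitrary: f g) simp_all

lemma qconv_add:
  "qconv q (\<lambda>u. f u + f' u) g w = qconv q f g w + qconv q f' g w"
  "qconv q g (\<lambda>u. f u + f' u) w = qconv q g f w + qconv q g f' w"
  by (induction w arbitrary: f f' g) (simp_all add: algebra_simps sum.distrib split_def)

lemma qconv_smul:
  "qconv q (\<lambda>u. smul c (f u)) g w = smul c (qconv q f g w)"
  "qconv q g (\<lambda>u. smul c (f u)) w = smul c (qconv q g f w)"
  by (induction w arbitrary: f g) (simp_all add: smul_sum split_def mult.commute[of q])

lemma qconv_sum: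
  "qconv q (\<lambda>u. \<Sum>k\<in>K. f k u) g w = (\<Sum>k\<in>K. qconv q (f k) g w)"
  "qconv q g (\<lambda>u. \<Sum>k\<in>K. f k u) w = (\<Sum>k\<in>K. qconv q g (f k) w)"
  by (induction K rule: infinite_finite_induct) (simp_all add: qconv_add)

lemma lookup_Lplus:
  "Poly_Mapping.lookup (Lplus a x) [] = 0"
  "Poly_Mapping.lookup (Lplus a x) (b # w) = (if a = b then Poly_Mapping.lookup x w else 0)"
  by (induction rule: span_induct[OF in_span_UNIV[of x]])
    (simp_all add: lookup_add lookup_basis)

lemma qconv_empty_word:
  "qconv q (\<lambda>u. smul (Poly_Mapping.lookup (basis []) u) P) g w = P * g w"
  "qconv q g (\<lambda>u. smul (Poly_Mapping.lookup (basis []) u) P) w = g w * P"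
  by (induction w arbitrary: g) (simp_all add: lookup_basis)

lemma qconv_delta:
  assumes "u \<in> lists Hbar" "v \<in> lists Hbar"
  shows "qconv q (\<lambda>w. smul (Poly_Mapping.lookup (basis u) w) P)
      (\<lambda>w. smul (Poly_Mapping.lookup (basis v) w) P') w =
    smul (Poly_Mapping.lookup (qsh q u v) w) (P * P')"
  using assms
proof (induction w arbitrary: u v rule: list.induct)
  case Nil
  then show ?case by (cases u; cases v) (simp_all add: lookup_basis lookup_add lookup_Lplus)
next
  case (Cons \<eta> w)
  let ?\<delta> = "\<lambda>u P w. smul (Poly_Mapping.lookup (basis u) w) P"
  have shift: "(\<lambda>w. ?\<delta> (a # u) P (b # w)) = (if a = b then ?\<delta> u P else (\<lambda>w. 0))"
    "(\<lambda>w. ?\<delta> [] P (b # w)) = (\<lambda>w. 0)" for a b u P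
    by (auto simp: lookup_basis)
  show ?case
  proof (cases "u = [] \<or> v = []")
    case True
    then show ?thesis by (elim disjE) (simp_all add: qconv_empty_word del: qconv.simps)
  next
    case False
    then obtain a u' b v' where uv: "u = a # u'" "v = b # v'" by (meson list.exhaust)
    have ab: "a \<in> Hbar" "b \<in> Hbar" and uv': "u' \<in> lists Hbar" "v' \<in> lists Hbar"
      using Cons.prems by (auto simp: uv)
    have "(\<Sum>(\<alpha>, \<beta>)\<in>letter_splits \<eta>. qconv q (\<lambda>w. ?\<delta> u P (\<alpha> # w)) (\<lambda>w. ?\<delta> v P' (\<beta> # w)) w) =
        (\<Sum>s\<in>letter_splits \<eta>. if s = (a, b) then qconv q (?\<delta> u' P) (?\<delta> v' P') w else 0)"
      unfolding uv shift by (intro sum.cong) (auto split: if_splits)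
    also have "\<dots> = (if a + b = \<eta> then smul (Poly_Mapping.lookup (qsh q u' v') w) (P * P') else 0)"
      using ab by (simp add: letter_splits_def[of \<eta>, symmetric] Cons.IH[OF uv'])
        (simp add: letter_splits_def)
    finally have split: "(\<Sum>(\<alpha>, \<beta>)\<in>letter_splits \<eta>.
          qconv q (\<lambda>w. ?\<delta> u P (\<alpha> # w)) (\<lambda>w. ?\<delta> v P' (\<beta> # w)) w) =
        (if a + b = \<eta> then smul (Poly_Mapping.lookup (qsh q u' v') w) (P * P') else 0)" .
    have left: "qconv q (\<lambda>w. ?\<delta> u P (\<eta> # w)) (?\<delta> v P') w =
        (if a = \<eta> then smul (Poly_Mapping.lookup (qsh q u' v) w) (P * P') else 0)"
      using Cons.IH[OF uv'(1) Cons.prems(2)] unfolding uv shift by simp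
    have right: "qconv q (?\<delta> u P) (\<lambda>w. ?\<delta> v P' (\<eta> # w)) w =
        (if b = \<eta> then smul (Poly_Mapping.lookup (qsh q u v') w) (P * P') else 0)"
      using Cons.IH[OF Cons.prems(1) uv'(2)] unfolding uv shift by simp
    show ?thesis
      unfolding qconv.simps left right split
      by (simp add: uv lookup_add lookup_Lplus smul_add_left)
  qed
qed

text \<open>On series with finitely many words, \<open>qconv\<close> is the quasishuffle product. The letters must lie
  in \<open>Hbar\<close>, since \<open>letter_splits\<close> only recombines such letters.\<close>

lemma qconv_qM:
  assumes "x \<in> Conc Hbar" "y \<in> Conc Hbar"
  shows "qconv q (\<lambda>w. smul (Poly_Mapping.lookup x w) P) (\<lambda>w. smul (Poly_Mapping.lookup y w) P') w =
    smul (Poly_Mapping.lookup (qM q x y) w) (P * P')"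
  using assms(1) unfolding Conc_def
proof (induction rule: span_induct)
  case (add c u x)
  have "qconv q (\<lambda>w. smul (Poly_Mapping.lookup (basis u) w) P)
      (\<lambda>w. smul (Poly_Mapping.lookup y w) P') w =
    smul (Poly_Mapping.lookup (qM q (basis u) y) w) (P * P')"
    using assms(2) unfolding Conc_def
  proof (induction rule: span_induct)
    case (add d v y)
    then show ?case using qconv_delta[OF \<open>u \<in> lists Hbar\<close> \<open>v \<in> lists Hbar\<close>, of q P P' w]
      by (simp add: lookup_add smul_add_left qconv_add qconv_smul flip: smul_simps(4))
  qed simp
  then show ?case using add
    by (simp add: lookup_add smul_add_left qconv_add qconv_smul flip: smul_simps(4))
qed simp

section \<open>Coarborification\<close>

text \<open>A tree acts as a vector field, so its values on the variables are its coefficients.\<close>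

definition tree_coeff :: "('a \<Rightarrow> 'n::finite oper) \<Rightarrow> 'a tree \<Rightarrow> 'n \<Rightarrow> 'n cpoly"
  where "tree_coeff E T i = rho_lt_tree E T (X i)"

lemma rho_lt_forest_dnprod: "rho_lt_forest E F = dnprod (tree_coeff E) F"
proof
  fix u
  obtain Ts where F: "F = mset Ts" by (metis ex_mset)
  show "rho_lt_forest E F u = dnprod (tree_coeff E) F u"
    unfolding F rho_lt_forest_mset dnprod_def nprod_mset by (simp add: tree_coeff_def)
qed

lemma rho_lt_forest_tree_X: "rho_lt_forest E {#Node \<eta> F#} (X i) = rho_lt_forest E F (E \<eta> (X i))"
  unfolding rho_lt_forest_single rho_lt_tree_X by (simp add: rho_def)

context letter_operators
begin

lemma fold_add: "fold E w (p + p') = fold E w p + fold E w p'"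
  by (induction w arbitrary: p p') (simp_all add: E_add)

lemma fold_smul: "fold E w (smul d p) = smul d (fold E w p)"
  by (induction w arbitrary: p) (simp_all add: E_smul)

lemma fold_zero: "fold E w 0 = 0"
  using fold_smul[of w 0 0] by simp

lemma fold_sum: "fold E w (\<Sum>k\<in>K. f k) = (\<Sum>k\<in>K. fold E w (f k))"
  by (induction K rule: infinite_finite_induct) (simp_all add: fold_add fold_zero)

text \<open>Stripping the first letter \<open>\<eta>\<close> of the word replaces \<open>p\<close> by \<open>E \<eta> p\<close>; hence the rule
  \<open>E_mult\<close> for one letter is literally the recursion of \<open>qconv\<close>.\<close>

lemma fold_mult: "fold E w (p * p') = qconv q (\<lambda>u. fold E u p) (\<lambda>u. fold E u p') w"
proof (induction w arbitrary: p p')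
  case (Cons \<eta> w)
  have "fold E (\<eta> # w) (p * p') = fold E w (E \<eta> p * p') + fold E w (p * E \<eta> p')
      + smul q (\<Sum>(\<alpha>, \<beta>)\<in>letter_splits \<eta>. fold E w (E \<alpha> p * E \<beta> p'))"
    by (simp add: E_mult fold_add fold_smul fold_sum split_def)
  then show ?case by (simp add: Cons.IH)
qed simp

definition coarb :: "(int ^ 'n) list \<Rightarrow> 'n oper"
  where "coarb w = rho_lt E (graded_dual H (arbo (qM q)) (basis w))"

lemma lookup_arbo_eq_0:
  "sum_list w \<noteq> forest_sum F \<Longrightarrow> Poly_Mapping.lookup (arbo_forest (qM q) F) w = 0"
  using arbo_forest_homogeneous[of q F] by (auto simp: linear_span_def in_keys_iff)

text \<open>Arborification preserves the total decoration, so only the finitely many forests whose total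
  decoration is that of \<open>w\<close> matter, and the sum may be taken over any larger finite set.\<close>

lemma coarb_eq:
  assumes "finite K" "K \<subseteq> forests H"
    and "\<And>F. F \<in> forests H \<Longrightarrow> forest_sum F = sum_list w \<Longrightarrow> F \<in> K"
  shows "coarb w p =
    (\<Sum>F\<in>K. smul (Poly_Mapping.lookup (arbo_forest (qM q) F) w) (rho_lt_forest E F p))"
proof -
  have c: "Poly_Mapping.lookup (graded_dual H (arbo (qM q)) (basis w)) F =
      (if F \<in> forests H then Poly_Mapping.lookup (arbo_forest (qM q) F) w else 0)" for F
    by (simp add: lookup_graded_dual_qM pairing_basis)
  have "Poly_Mapping.keys (graded_dual H (arbo (qM q)) (basis w)) \<subseteq> K"
  proof
    fix F assume "F \<in> Poly_Mapping.keys (graded_dual H (arbo (qM q)) (basis w))"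
    then have "F \<in> forests H" "Poly_Mapping.lookup (arbo_forest (qM q) F) w \<noteq> 0"
      by (simp_all add: in_keys_iff c split: if_splits)
    then show "F \<in> K" using assms(3) lookup_arbo_eq_0 by metis
  qed
  then show ?thesis
    unfolding coarb_def rho_lt_def using assms(1,2)
    by (subst lin_ext_superset[of K]) (auto simp: c intro!: sum.cong)
qed

lemma coarb_linear: "coarb w (p + p') = coarb w p + coarb w p'"
  "coarb w (smul d p) = smul d (coarb w p)"
  by (simp_all add: coarb_def rho_lt_def rho_lt_forest_dnprod lin_ext_add_fun lin_ext_smul_fun)

abbreviation forests_upto :: "nat \<Rightarrow> (int ^ 'n) forest set"
  where "forests_upto n \<equiv> {F \<in> forests H. gr (forest_sum F) \<le> int n}"

lemma coarb_upto:
  assumes "gr (sum_list w) \<le> int n"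
  shows "coarb w p = (\<Sum>F\<in>forests_upto n.
    smul (Poly_Mapping.lookup (arbo_forest (qM q) F) w) (rho_lt_forest E F p))"
  by (rule coarb_eq[OF finite_forests_gr_le]) (use assms in auto)

lemma forest_sum_union [simp]: "forest_sum (F + G) = forest_sum F + forest_sum G"
  by (simp add: forest_sum_def)

text \<open>Combine the Leibniz rule of \<open>rho_lt_forest\<close> with the multiplicativity of arborification.
  Bilinearity of \<open>qconv\<close> needs one finite range of summation for all words involved: the forests
  of degree at most that of \<open>w\<close> will do.\<close>

lemma coarb_mult:
  assumes w: "w \<in> lists Hbar"
  shows "coarb w (p * p') = qconv q (\<lambda>u. coarb u p) (\<lambda>u. coarb u p') w"
proof -
  define n where "n = nat (gr (sum_list w))"
  have n: "int n = gr (sum_list w)" using gr_lists_Hbar[OF w] by (simp add: n_def)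
  let ?K = "forests_upto n"
  let ?c = "\<lambda>F u. Poly_Mapping.lookup (arbo_forest (qM q) F) u"
  let ?R = "rho_lt_forest E"
  let ?h = "\<lambda>A B. smul (?c (A + B) w) (?R A p * ?R B p')"
  \<comment> \<open>Pairs in \<open>?K \<times> ?K\<close> of too large total degree have coefficient \<open>0\<close>, so the sum over
    \<open>A + B \<in> ?K\<close> may be replaced by a double sum.\<close>
  have sub: "{(A, B). A + B \<in> ?K} \<subseteq> ?K \<times> ?K"
  proof
    fix s assume "s \<in> {(A, B). A + B \<in> ?K}"
    then obtain A B where s: "s = (A, B)" "A \<in> forests H" "B \<in> forests H"
        "gr (forest_sum A) + gr (forest_sum B) \<le> int n"
      by (auto simp: forests_def)
    then show "s \<in> ?K \<times> ?K"
      using gr_forest_sum[OF s(2)] gr_forest_sum[OF s(3)] by simp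
  qed
  have vanish: "?h A B = 0" if "A \<in> ?K" "B \<in> ?K" "A + B \<notin> ?K" for A B
  proof -
    have "A + B \<in> forests H" using that by (auto simp: forests_def)
    then have "sum_list w \<noteq> forest_sum (A + B)" using that n by auto
    then show ?thesis using lookup_arbo_eq_0[of w "A + B"] by simp
  qed
  have Conc: "arbo_forest (qM q) F \<in> Conc Hbar" if "F \<in> ?K" for F
    using arbo_qM_Conc[of q Hbar H "basis F"] that
    by (auto simp: CK_def intro: Hbar.intros)
  have trunc: "(\<Sum>F\<in>?K. smul (?c F u) (?R F v)) = coarb u v"
    if "gr (sum_list u) \<le> gr (sum_list w)" for u v
    using coarb_upto[of u n v] that by (simp only: n)
  have "coarb w (p * p') = (\<Sum>F\<in>?K. smul (?c F w) (?R F (p * p')))"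
    by (rule coarb_upto) (simp add: n)
  also have "\<dots> = (\<Sum>F\<in>?K. \<Sum>(A, B) | A + B = F. ?h A B)"
    unfolding rho_lt_forest_dnprod dnprod_mult smul_sum
    by (intro sum.cong refl) auto
  also have "\<dots> = (\<Sum>(A, B) | A + B \<in> ?K. ?h A B)"
    by (rule sum_mset_pairs_sum(2)[OF finite_forests_gr_le])
  also have "\<dots> = (\<Sum>(A, B)\<in>?K \<times> ?K. ?h A B)"
    using sub vanish by (intro sum.mono_neutral_left finite_cartesian_product finite_forests_gr_le) auto
  also have "\<dots> = (\<Sum>A\<in>?K. \<Sum>B\<in>?K. ?h A B)"
    by (simp add: sum.cartesian_product)
  also have "\<dots> = (\<Sum>A\<in>?K. \<Sum>B\<in>?K. qconv q (\<lambda>u. smul (?c A u) (?R A p)) (\<lambda>u. smul (?c B u) (?R B p')) w)"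
    by (intro sum.cong refl) (simp only: arbo_forest_union qconv_qM[OF Conc Conc])
  also have "\<dots> = qconv q (\<lambda>u. \<Sum>A\<in>?K. smul (?c A u) (?R A p)) (\<lambda>u. \<Sum>B\<in>?K. smul (?c B u) (?R B p')) w"
    by (simp only: qconv_sum)
  also have "\<dots> = qconv q (\<lambda>u. coarb u p) (\<lambda>u. coarb u p') w"
    by (rule qconv_cong[OF w]) (simp_all add: trunc)
  finally show ?thesis .
qed

lemma coarb_Nil: "coarb [] p = p"
proof -
  have "F = {#}" if "F \<in> forests H" "forest_sum F = (0 :: int ^ 'n)" for F
    using gr_forest_sum[OF that(1)] that(2) by simp
  then have "coarb [] p = (\<Sum>F\<in>{{#}}.
      smul (Poly_Mapping.lookup (arbo_forest (qM q) F) []) (rho_lt_forest E F p))"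
    by (intro coarb_eq) auto
  then show ?thesis
    by (simp add: rho_lt_forest_empty arbo_forest_def lookup_basis)
qed

lemma coarb_Cons_one: "coarb (\<eta> # w) 1 = 0"
proof -
  let ?K = "forests_upto (nat (gr (sum_list (\<eta> # w))))"
  have "coarb (\<eta> # w) 1 = (\<Sum>F\<in>?K.
      smul (Poly_Mapping.lookup (arbo_forest (qM q) F) (\<eta> # w)) (rho_lt_forest E F 1))"
    by (rule coarb_upto) simp
  also have "\<dots> = 0"
  proof (intro sum.neutral ballI)
    fix F :: "(int ^ 'n) forest"
    show "smul (Poly_Mapping.lookup (arbo_forest (qM q) F) (\<eta> # w)) (rho_lt_forest E F 1) = 0"
      by (cases "F = {#}") (simp_all add: arbo_forest_def lookup_basis rho_lt_forest_dnprod dnprod_one)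
  qed
  finally show ?thesis .
qed

text \<open>Forests other than single trees annihilate \<open>x\<^sub>i\<close> or have no nonempty word in their image, and
  the coefficient of \<open>\<eta> # w\<close> in \<open>\<alpha>(B\<^sup>+\<^bsub>\<theta>\<^esub>(G))\<close> is that of \<open>w\<close> in \<open>\<alpha>(G)\<close> if \<open>\<theta> = \<eta>\<close> and \<open>0\<close>
  otherwise. If \<open>\<eta>\<close> lies outside \<open>H\<close>, no tree has root \<open>\<eta>\<close> and both sides vanish.\<close>

lemma coarb_Cons_X: "coarb (\<eta> # w) (X i) = coarb w (E \<eta> (X i))"
proof -
  \<comment> \<open>The degree of \<open>\<eta>\<close> may be negative when \<open>\<eta> \<notin> Hbar\<close>, hence the maximum.\<close>
  define n where "n = nat (max (gr (sum_list (\<eta> # w))) (gr (sum_list w)))"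
  have n: "gr (sum_list (\<eta> # w)) \<le> int n" "gr (sum_list w) \<le> int n"
    by (simp_all only: n_def nat_le_iff[symmetric] nat_mono max.cobounded1 max.cobounded2)
  let ?K = "forests_upto n"
  let ?c = "\<lambda>F u. Poly_Mapping.lookup (arbo_forest (qM q) F) u"
  let ?R = "rho_lt_forest E"
  let ?T = "\<lambda>G. {#Node \<eta> G#}"
  have c_tree: "?c {#Node \<theta> G#} (\<eta> # w) = (if \<theta> = \<eta> then ?c G w else 0)" for \<theta> G
    by (simp add: arbo_forest_single lookup_Lplus)
  have inj: "inj_on ?T S" for S by (simp add: inj_on_def)
  show ?thesis
  proof (cases "\<eta> \<in> H")
    case True
    have zero: "smul (?c F (\<eta> # w)) (?R F (X i)) = 0" if "F \<notin> ?T ` ?K" "F \<in> ?K \<union> ?T ` ?K" for F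
    proof (cases "size F = 1")
      case True
      then obtain \<theta> G where F: "F = {#Node \<theta> G#}"
        by (metis size_1_singleton_mset tree.exhaust)
      have "\<theta> \<noteq> \<eta> \<or> ?c G w = 0"
      proof (rule ccontr)
        assume "\<not> ?thesis"
        then have "\<theta> = \<eta>" "sum_list w = forest_sum G"
          using lookup_arbo_eq_0 by auto
        moreover have "G \<in> forests H" using that F by auto
        ultimately have "G \<in> ?K" using n(2) by simp
        then show False using that F \<open>\<theta> = \<eta>\<close> by blast
      qed
      then show ?thesis by (auto simp: F c_tree)
    next
      case False
      then consider "F = {#}" | "size F > 1" by (cases "size F") auto
      then show ?thesis
        by cases (simp_all add: arbo_forest_def lookup_basis rho_lt_forest_dnprod dnprod_X_0)
    qed
    have "coarb (\<eta> # w) (X i) = (\<Sum>F\<in>?K \<union> ?T ` ?K. smul (?c F (\<eta> # w)) (?R F (X i)))"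
      by (rule coarb_eq) (use True n(1) finite_forests_gr_le in auto)
    also have "\<dots> = (\<Sum>F\<in>?T ` ?K. smul (?c F (\<eta> # w)) (?R F (X i)))"
      using zero finite_forests_gr_le by (intro sum.mono_neutral_right) auto
    also have "\<dots> = (\<Sum>G\<in>?K. smul (?c G w) (?R G (E \<eta> (X i))))"
      by (subst sum.reindex[OF inj]) (simp add: c_tree rho_lt_forest_tree_X)
    also have "\<dots> = coarb w (E \<eta> (X i))"
      by (rule coarb_upto[symmetric, OF n(2)])
    finally show ?thesis .
  next
    case False
    have "coarb (\<eta> # w) (X i) = (\<Sum>F\<in>?K. smul (?c F (\<eta> # w)) (?R F (X i)))"
      by (rule coarb_upto[OF n(1)])
    also have "\<dots> = 0"
    proof (intro sum.neutral ballI)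
      fix F assume F: "F \<in> ?K"
      consider "F = {#}" | \<theta> G where "F = {#Node \<theta> G#}" | "size F > 1"
        by (metis One_nat_def Suc_lessI nonempty_has_size size_1_singleton_mset tree.exhaust)
      then show "smul (?c F (\<eta> # w)) (?R F (X i)) = 0"
      proof cases
        case 2
        then have "\<theta> \<noteq> \<eta>" using F False by auto
        then show ?thesis by (simp add: 2 c_tree)
      qed (simp_all add: arbo_forest_def lookup_basis rho_lt_forest_dnprod dnprod_X_0)
    qed
    also have "0 = coarb w (E \<eta> (X i))"
      using coarb_linear(2)[of w 0 0] by (simp add: E_X[OF False])
    finally show ?thesis .
  qed
qed

text \<open>The outer induction is on the degree of \<open>w\<close>, with arbitrary \<open>p\<close>, because the case of a
  variable passes from \<open>(\<eta> # v, x\<^sub>i)\<close> to \<open>(v, E \<eta> x\<^sub>i)\<close>. The inner induction on \<open>p\<close> treats all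
  words of at most that degree simultaneously, as the product rule involves all of them.\<close>

lemma coarb_eq_fold:
  "w \<in> lists Hbar \<Longrightarrow> coarb w p = fold E w p"
proof (induction "nat (gr (sum_list w))" arbitrary: w p rule: less_induct)
  case less
  have "\<forall>u\<in>lists Hbar. gr (sum_list u) \<le> gr (sum_list w) \<longrightarrow> coarb u p = fold E u p"
  proof (induction p rule: cpoly_induct)
    case one
    have "fold E (\<eta> # u) 1 = 0" for \<eta> u by (simp add: E_one fold_zero)
    then show ?case by (metis coarb_Nil coarb_Cons_one fold_simps(1) list.exhaust)
  next
    case (X i)
    show ?case
    proof (intro ballI impI)
      fix u :: "(int ^ 'n) list"
      assume u: "u \<in> lists Hbar" "gr (sum_list u) \<le> gr (sum_list w)"
      show "coarb u (X i) = fold E u (X i)"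
      proof (cases u)
        case (Cons \<eta> v)
        have "v \<in> lists Hbar" "1 \<le> gr \<eta>" using u(1) by (auto simp: Cons gr_Hbar)
        then have "nat (gr (sum_list v)) < nat (gr (sum_list w))"
          using u(2) gr_lists_Hbar[of v] by (simp add: Cons)
        then show ?thesis
          using less.hyps \<open>v \<in> lists Hbar\<close> by (simp add: Cons coarb_Cons_X)
      qed (simp add: coarb_Nil)
    qed
  next
    case (mult p p')
    show ?case
    proof (intro ballI impI)
      fix u :: "(int ^ 'n) list"
      assume u: "u \<in> lists Hbar" "gr (sum_list u) \<le> gr (sum_list w)"
      show "coarb u (p * p') = fold E u (p * p')"
        unfolding coarb_mult[OF u(1)] fold_mult
        by (rule qconv_cong[OF u(1)]) (use mult u(2) in auto)
    qed
  qed (simp_all add: coarb_linear fold_add fold_smul)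
  then show ?case using less.prems by blast
qed

text \<open>Both sides are linear in \<open>u\<close>, so the case of words suffices.\<close>

theorem rho_lt_graded_dual:
  assumes "u \<in> Conc Hbar"
  shows "rho_lt E (graded_dual H (arbo (qM q)) u) = rho E u"
proof
  fix p
  have pairing_left: "pairing 0 v = 0" "pairing (x + y) v = pairing x v + pairing y v"
    "pairing (smul c x) v = c * pairing x v" for v x y :: "(int ^ 'n) list \<Rightarrow>\<^sub>0 complex" and c
    by (induction rule: span_induct[OF in_span_UNIV[of v]])
      (simp_all add: pairing_basis_right lookup_add algebra_simps)
  have dual: "graded_dual H (arbo (qM q)) (0 :: (int ^ 'n) list \<Rightarrow>\<^sub>0 complex) = 0"
    "graded_dual H (arbo (qM q)) (smul c x + y) =
      smul c (graded_dual H (arbo (qM q)) x) + graded_dual H (arbo (qM q)) y"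
    for x y :: "(int ^ 'n) list \<Rightarrow>\<^sub>0 complex" and c
    by (auto intro!: poly_mapping_eqI
        simp: lookup_graded_dual_qM lookup_add pairing_left simp del: arbo_simps)
  show "rho_lt E (graded_dual H (arbo (qM q)) u) p = rho E u p"
    using assms unfolding Conc_def
  proof (induction rule: span_induct)
    case zero
    show ?case by (simp add: dual rho_lt_def rho_def)
  next
    case (add c w u)
    have "rho_lt E (graded_dual H (arbo (qM q)) (basis w)) p = fold E w p"
      using coarb_eq_fold[OF add(1)] by (simp add: coarb_def)
    then show ?case using add(3) by (simp add: dual rho_lt_def rho_def)
  qed
qed

end

theorem theorem7:
  fixes a :: "'n::finite \<Rightarrow> int ^ 'n \<Rightarrow> complex"
  assumes "\<And>i \<eta>. \<eta> \<notin> Hi i \<Longrightarrow> a i \<eta> = 0"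
  shows "(\<forall>u\<in>Conc H. rho_lt (B_op a) (graded_dual H (arbo sh_mult) u) = rho (B_op a) u) \<and>
    (\<forall>u\<in>Conc Hbar. rho_lt (D_op a) (graded_dual H (arbo qsh_mult) u) = rho (D_op a) u)"
proof -
  interpret B: letter_operators 0 "B_op a" using assms by (rule letter_operators_B)
  interpret D: letter_operators 1 "D_op a" using assms by (rule letter_operators_D)
  have "u \<in> Conc H \<Longrightarrow> u \<in> Conc Hbar" for u :: "(int ^ 'n) list \<Rightarrow>\<^sub>0 complex"
    unfolding Conc_def linear_span_def using lists_mono[of H Hbar] Hbar.intros(1) by blast
  then show ?thesis
    using B.rho_lt_graded_dual D.rho_lt_graded_dual by (simp add: sh_mult_qM qsh_mult_qM)
qed

end
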